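(* Let $0\le s\in\mathbb{R}$ and let $H^s(\mathbb{R}^N)$ be equipped with the norm $$\|u\|_{H^s(\mathbb{R}^N)}=\big\|(1+4\pi^2|\cdot|^2)^{s/2}\mathcal{F}u\big\|_{L_2(\mathbb{R}^N)}$$ and corresponding inner product $\langle u,v\rangle_{H^s(\mathbb{R}^N)}=\int_{\mathbb{R}^N}(1+4\pi^2|\xi|^2)^s(\mathcal{F}u)(\xi)\overline{(\mathcal{F}v)(\xi)}\,d\xi$. Then for each $u\in L_2(\mathbb{R}^N)$ the element $E_s^*u$ is given by $$E_s^*u=(I-\Delta)^{-s}u,$$ where $(I-\Delta)^{-s}$ denotes the Bessel potential operator.
   Context: $N\in\mathbb{N}$; $L_2(\mathbb{R}^N)$ is the complex Lebesgue space with $\langle u,v\rangle_{L_2(\mathbb{R}^N)}=\int u\overline v\,dx$. The Fourier transform is $(\mathcal{F}u)(\xi)=\int_{\mathbb{R}^N}e^{-2\pi i\xi\cdot x}u(x)\,dx$ and $(\mathcal{F}^{-1}u)(x)=\int_{\mathbb{R}^N}e^{2\pi ix\cdot\xi}u(\xi)\,d\xi$, extended to bounded, mutually inverse operators on $L_2(\mathbb{R}^N)$. For $s\in\mathbb{R}$ the Bessel potential operator of order $s$ is defined by $$(I-\Delta)^{-s/2}u(x):=\mathcal{F}^{-1}\Big((1+4\pi^2|\cdot|^2)^{-s/2}\mathcal{F}u\Big)(x).$$ $H^s(\mathbb{R}^N)$ is the set of $u\in L_2(\mathbb{R}^N)$ with $\mathcal{F}^{-1}\big((1+4\pi^2|\cdot|^2)^{s/2}\mathcal{F}u\big)\in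 L_2(\mathbb{R}^N)$. $E_s:H^s(\mathbb{R}^N)\to L_2(\mathbb{R}^N)$, $E_su:=u$, is the embedding operator, and its adjoint $E_s^*:L_2(\mathbb{R}^N)\to H^s(\mathbb{R}^N)$ is defined by $\langle E_s^*u,v\rangle_{H^s(\mathbb{R}^N)}=\langle u,v\rangle_{L_2(\mathbb{R}^N)}$ for all $u\in L_2(\mathbb{R}^N)$, $v\in H^s(\mathbb{R}^N)$. *)

theory Defs
  imports "HOL-Analysis.Analysis"
begin

text \<open>
  Elements of \<open>L\<^sub>2\<close> are represented by functions, so equality in \<open>L\<^sub>2\<close> is equality almost
  everywhere. Operators on \<open>L\<^sub>2\<close> return an arbitrary representative of their value.
\<close>

definition L2 :: "('a::euclidean_space \<Rightarrow> complex) set" where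
  "L2 = {u. u \<in> borel_measurable lebesgue \<and> integrable lebesgue (\<lambda>x. (norm (u x))\<^sup>2)}"

definition L2_inner :: "('a::euclidean_space \<Rightarrow> complex) \<Rightarrow> ('a \<Rightarrow> complex) \<Rightarrow> complex" where
  "L2_inner u v = (LINT x|lebesgue. u x * cnj (v x))"

definition L2_norm :: "('a::euclidean_space \<Rightarrow> complex) \<Rightarrow> real" where
  "L2_norm u = sqrt (LINT x|lebesgue. (norm (u x))\<^sup>2)"

text \<open>
  The distance is measured by a nonnegative integral: it is infinite, rather than \<open>0\<close>, when
  the difference is measurable but not square integrable.
\<close>

definition L2_tendsto ::
    "(nat \<Rightarrow> 'a::euclidean_space \<Rightarrow> complex) \<Rightarrow> ('a \<Rightarrow> complex) \<Rightarrow> bool" where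
  "L2_tendsto f u \<longleftrightarrow>
    (\<lambda>n. \<integral>\<^sup>+x. ennreal ((norm (f n x - u x))\<^sup>2) \<partial>lebesgue) \<longlonglongrightarrow> 0"

definition fourier_integral ::
    "('a::euclidean_space \<Rightarrow> complex) \<Rightarrow> 'a \<Rightarrow> complex" where
  "fourier_integral u \<xi> =
    (LINT x|lebesgue. exp (- (2 * of_real pi * \<i> * of_real (\<xi> \<bullet> x))) * u x)"

definition inv_fourier_integral ::
    "('a::euclidean_space \<Rightarrow> complex) \<Rightarrow> 'a \<Rightarrow> complex" where
  "inv_fourier_integral u x =
    (LINT \<xi>|lebesgue. exp (2 * of_real pi * \<i> * of_real (x \<bullet> \<xi>)) * u \<xi>)"

text \<open>
  Extension by continuity of an operator given on the dense subspace of integrable functions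
  in \<open>L\<^sub>2\<close>. For \<open>u\<close> outside \<open>L\<^sub>2\<close> the value is of no significance.
\<close>

definition L2_extension ::
    "(('a::euclidean_space \<Rightarrow> complex) \<Rightarrow> 'a \<Rightarrow> complex) \<Rightarrow> ('a \<Rightarrow> complex) \<Rightarrow> 'a \<Rightarrow> complex" where
  "L2_extension T u = (SOME v. v \<in> L2 \<and>
    (\<forall>f. (\<forall>n. f n \<in> L2 \<and> integrable lebesgue (f n)) \<and> L2_tendsto f u
      \<longrightarrow> L2_tendsto (\<lambda>n. T (f n)) v))"

definition fourier :: "('a::euclidean_space \<Rightarrow> complex) \<Rightarrow> 'a \<Rightarrow> complex" where
  "fourier = L2_extension fourier_integral"

definition inv_fourier :: "('a::euclidean_space \<Rightarrow> complex) \<Rightarrow> 'a \<Rightarrow> complex" where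
  "inv_fourier = L2_extension inv_fourier_integral"

text \<open>The symbol of \<open>(I - \<Delta>)\<^sup>t\<close>.\<close>

definition bessel_symbol :: "real \<Rightarrow> 'a::euclidean_space \<Rightarrow> real" where
  "bessel_symbol t \<xi> = (1 + 4 * pi\<^sup>2 * (norm \<xi>)\<^sup>2) powr t"

text \<open>
  The Bessel potential operator of order \<open>s\<close> is \<open>(I - \<Delta>)\<close> to the power \<open>- s / 2\<close>;
  in particular, \<open>(I - \<Delta>)\<close> to the power \<open>- s\<close> has order \<open>2 * s\<close>.
\<close>

definition bessel_potential ::
    "real \<Rightarrow> ('a::euclidean_space \<Rightarrow> complex) \<Rightarrow> 'a \<Rightarrow> complex" where
  "bessel_potential s u =
    inv_fourier (\<lambda>\<xi>. of_real (bessel_symbol (- s / 2) \<xi>) * fourier u \<xi>)"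

text \<open>
  The membership of the weighted transform in \<open>L2\<close> says that \<open>inv_fourier\<close>, an operator on
  \<open>L\<^sub>2\<close>, is applied within its domain.
\<close>

definition sobolev_space :: "real \<Rightarrow> ('a::euclidean_space \<Rightarrow> complex) set" where
  "sobolev_space s = {u \<in> L2.
    (\<lambda>\<xi>. of_real (bessel_symbol (s / 2) \<xi>) * fourier u \<xi>) \<in> L2 \<and>
    inv_fourier (\<lambda>\<xi>. of_real (bessel_symbol (s / 2) \<xi>) * fourier u \<xi>) \<in> L2}"

definition sobolev_norm :: "real \<Rightarrow> ('a::euclidean_space \<Rightarrow> complex) \<Rightarrow> real" where
  "sobolev_norm s u = L2_norm (\<lambda>\<xi>. of_real (bessel_symbol (s / 2) \<xi>) * fourier u \<xi>)"

definition sobolev_inner ::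
    "real \<Rightarrow> ('a::euclidean_space \<Rightarrow> complex) \<Rightarrow> ('a \<Rightarrow> complex) \<Rightarrow> complex" where
  "sobolev_inner s u v =
    (LINT \<xi>|lebesgue. of_real (bessel_symbol s \<xi>) * fourier u \<xi> * cnj (fourier v \<xi>))"

lemma sobolev_inner_self: "sobolev_inner s u u = of_real ((sobolev_norm s u)\<^sup>2)"
proof -
  have *: "(bessel_symbol (s / 2) \<xi>)\<^sup>2 = bessel_symbol s \<xi>" for \<xi> :: 'a
    by (simp add: bessel_symbol_def power2_eq_square flip: powr_add)
  have **: "0 \<le> bessel_symbol s \<xi>" for \<xi> :: 'a
    by (simp add: bessel_symbol_def)
  have "(sobolev_norm s u)\<^sup>2 = (LINT \<xi>|lebesgue. bessel_symbol s \<xi> * (norm (fourier u \<xi>))\<^sup>2)"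
    by (simp add: sobolev_norm_def L2_norm_def norm_mult power_mult_distrib *
        Bochner_Integration.integral_nonneg **)
  moreover have "sobolev_inner s u u =
      (LINT \<xi>|lebesgue. of_real (bessel_symbol s \<xi> * (norm (fourier u \<xi>))\<^sup>2))"
    unfolding sobolev_inner_def
    by (intro Bochner_Integration.integral_cong refl)
      (simp add: complex_norm_square mult.assoc del: of_real_power)
  ultimately show ?thesis
    by (simp only: integral_complex_of_real)
qed

text \<open>
  The adjoint of the embedding \<open>v \<mapsto> v\<close> of the Sobolev space into \<open>L\<^sub>2\<close>.
\<close>

definition sobolev_embedding_adjoint ::
    "real \<Rightarrow> ('a::euclidean_space \<Rightarrow> complex) \<Rightarrow> 'a \<Rightarrow> complex" where
  "sobolev_embedding_adjoint s u = (SOME w. w \<in> sobolev_space s \<and>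
    (\<forall>v \<in> sobolev_space s. sobolev_inner s w v = L2_inner u v))"

end

theory Submission
  imports Defs "HOL-Probability.Characteristic_Functions"
begin

text \<open>
  By Plancherel's theorem, the equation \<open>\<langle>w, v\<rangle> = \<langle>u, v\<rangle>\<close> that defines \<open>w\<close> as the adjoint of the embedding
  applied to \<open>u\<close>, with the Sobolev inner product on the left and that of \<open>L\<^sub>2\<close> on the right, says on
  the frequency side that \<open>bessel_symbol s * fourier w - fourier u\<close> is orthogonal to the transform of
  every \<open>v\<close> in the Sobolev space. Its solution has \<open>fourier w = bessel_symbol (- s) * fourier u\<close>, which is
  the Bessel potential of order \<open>2 * s\<close> (\<open>sobolev_inner_bessel_potential\<close>). For \<open>s \<ge> 0\<close> the weight
  \<open>bessel_symbol (- s)\<close> is at most \<open>1\<close>, so this \<open>w\<close> lies in the Sobolev space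
  (\<open>bessel_potential_in_sobolev\<close>). The solution is unique up to null sets
  (\<open>sobolev_representer_unique\<close>), so the one chosen by \<open>sobolev_embedding_adjoint\<close> agrees with it.

  The bulk of the work is the theory of the Fourier transform on \<open>L\<^sub>2\<close>: that the extensions of the
  Fourier integrals exist, preserve the inner product (\<open>plancherel\<close>) and are inverse to each other
  (\<open>inv_fourier_fourier\<close>, \<open>fourier_inv_fourier\<close>).

  Parseval's identity is first proved for bounded continuous integrable functions
  (\<open>parseval_bcont\<close>): with a Gaussian damping factor on the frequency side, Fubini's theorem turns
  the pairing of the transforms of \<open>f\<close> and \<open>g\<close> into the pairing of \<open>f\<close> with a mollification of \<open>g\<close>, and the
  damping is removed by monotone and dominated convergence. Such functions approximate any element
  of \<open>L\<^sub>1 \<inter> L\<^sub>2\<close> in both norms at once (\<open>bcont_L1_dense\<close>), and Fatou's lemma carries the identity over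
  (\<open>parseval_fourier_integral\<close>). Completeness of \<open>L\<^sub>2\<close> then provides the extension
  (\<open>extension_exists\<close>). The two Fourier integrals are adjoint to each other by Fubini's theorem;
  since the adjoint of an isometry is a left inverse of it, inversion follows (\<open>extension_inverse\<close>).
\<close>

section \<open>Square-integrable functions\<close>

lemma borel_measurable_cnj [measurable (raw)]:
  "f \<in> borel_measurable M \<Longrightarrow> (\<lambda>x. cnj (f x)) \<in> borel_measurable M"
  by (rule borel_measurable_continuous_on[OF continuous_on_cnj[OF continuous_on_id]])

text \<open>
  The square of the \<open>L\<^sub>2\<close> norm as an extended nonnegative number, meaningful for every measurable
  function. Working with it avoids Minkowski's inequality: the quasi-triangle inequality with
  factor \<open>2\<close> below suffices for all limits.
\<close>

definition nn_sq :: "('a::euclidean_space \<Rightarrow> complex) \<Rightarrow> ennreal" where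
  "nn_sq u = (\<integral>\<^sup>+x. ennreal ((norm (u x))\<^sup>2) \<partial>lebesgue)"

lemma L2_tendsto_iff: "L2_tendsto f u \<longleftrightarrow> (\<lambda>n. nn_sq (\<lambda>x. f n x - u x)) \<longlonglongrightarrow> 0"
  by (simp add: L2_tendsto_def nn_sq_def)

lemma L2_iff: "u \<in> L2 \<longleftrightarrow> u \<in> borel_measurable lebesgue \<and> nn_sq u < \<infinity>"
  by (auto simp: L2_def nn_sq_def integrable_iff_bounded)

lemma L2_measurable [measurable_dest]: "u \<in> L2 \<Longrightarrow> u \<in> borel_measurable lebesgue"
  by (simp add: L2_def)

lemma nn_sq_finite: "u \<in> L2 \<Longrightarrow> nn_sq u < \<infinity>"
  by (simp add: L2_iff)

lemma nn_sq_mono_AE: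
  assumes "AE x in lebesgue. norm (u x) \<le> norm (v x)"
  shows "nn_sq u \<le> nn_sq v"
  unfolding nn_sq_def
  by (intro nn_integral_mono_AE) (use assms in \<open>auto intro!: ennreal_leI power_mono elim!: eventually_mono\<close>)

lemma nn_sq_cong_norm: "(\<And>x. norm (u x) = norm (v x)) \<Longrightarrow> nn_sq u = nn_sq v"
  by (simp add: nn_sq_def)

lemma nn_sq_minus_commute: "nn_sq (\<lambda>x. u x - v x) = nn_sq (\<lambda>x. v x - u x)"
  by (intro nn_sq_cong_norm) (simp add: norm_minus_commute)

lemma L2_dominated:
  assumes "v \<in> L2" "u \<in> borel_measurable lebesgue" "AE x in lebesgue. norm (u x) \<le> norm (v x)"
  shows "u \<in> L2"
  using assms nn_sq_mono_AE[OF assms(3)] by (auto simp: L2_iff intro: le_less_trans)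

lemma norm_add_sq_le:
  fixes a b :: "'b::real_normed_vector"
  shows "(norm (a + b))\<^sup>2 \<le> 2 * ((norm a)\<^sup>2 + (norm b)\<^sup>2)"
proof -
  have "(norm (a + b))\<^sup>2 \<le> (norm a + norm b)\<^sup>2"
    by (intro power_mono norm_triangle_ineq) auto
  also have "\<dots> \<le> 2 * ((norm a)\<^sup>2 + (norm b)\<^sup>2)"
    using sum_squares_ge_zero[of "norm a - norm b" 0] by (simp add: power2_eq_square algebra_simps)
  finally show ?thesis .
qed

lemma nn_sq_add_le:
  assumes [measurable]: "u \<in> borel_measurable lebesgue" "v \<in> borel_measurable lebesgue"
  shows "nn_sq (\<lambda>x. u x + v x) \<le> 2 * (nn_sq u + nn_sq v)"
proof -
  have "nn_sq (\<lambda>x. u x + v x) \<le> (\<integral>\<^sup>+x. 2 * (ennreal ((norm (u x))\<^sup>2) + ennreal ((norm (v x))\<^sup>2)) \<partial>lebesgue)"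
    unfolding nn_sq_def
  proof (intro nn_integral_mono)
    fix x
    have "ennreal ((norm (u x + v x))\<^sup>2) \<le> ennreal (2 * ((norm (u x))\<^sup>2 + (norm (v x))\<^sup>2))"
      by (intro ennreal_leI norm_add_sq_le)
    then show "ennreal ((norm (u x + v x))\<^sup>2) \<le> 2 * (ennreal ((norm (u x))\<^sup>2) + ennreal ((norm (v x))\<^sup>2))"
      by (simp add: ennreal_mult ennreal_plus)
  qed
  also have "\<dots> = 2 * (nn_sq u + nn_sq v)"
    unfolding nn_sq_def by (subst nn_integral_cmult, measurable, subst nn_integral_add) auto
  finally show ?thesis .
qed

lemma nn_sq_triangle:
  assumes "u \<in> borel_measurable lebesgue" "v \<in> borel_measurable lebesgue" "w \<in> borel_measurable lebesgue"
  shows "nn_sq (\<lambda>x. u x - w x) \<le> 2 * (nn_sq (\<lambda>x. u x - v x) + nn_sq (\<lambda>x. v x - w x))"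
  using nn_sq_add_le[of "\<lambda>x. u x - v x" "\<lambda>x. v x - w x"] assms by simp

lemma L2_add: "u \<in> L2 \<Longrightarrow> v \<in> L2 \<Longrightarrow> (\<lambda>x. u x + v x) \<in> L2"
  using nn_sq_add_le[of u v]
  by (auto simp: L2_iff ennreal_mult_less_top ennreal_add_less_top intro!: le_less_trans[OF nn_sq_add_le])

lemma L2_cmult: "u \<in> L2 \<Longrightarrow> (\<lambda>x. c * u x) \<in> L2"
  by (auto simp: L2_def norm_mult power_mult_distrib)

lemma L2_diff: "u \<in> L2 \<Longrightarrow> v \<in> L2 \<Longrightarrow> (\<lambda>x. u x - v x) \<in> L2"
  using L2_add[of u "\<lambda>x. (-1) * v x"] L2_cmult[of v "-1"] by simp

lemma L2_cnj_iff: "(\<lambda>x. cnj (u x)) \<in> L2 \<longleftrightarrow> u \<in> L2"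
proof -
  have "(\<lambda>x. cnj (u x)) \<in> L2" if "u \<in> L2" for u :: "'a \<Rightarrow> complex"
    using that by (auto simp: L2_def)
  from this[of u] this[of "\<lambda>x. cnj (u x)"] show ?thesis by auto
qed

lemma L2_bounded_mult:
  fixes b :: "'a::euclidean_space \<Rightarrow> real"
  assumes "u \<in> L2" "b \<in> borel_measurable lebesgue" "\<And>x. \<bar>b x\<bar> \<le> 1"
  shows "(\<lambda>x. of_real (b x) * u x) \<in> L2"
  using assms by (intro L2_dominated[OF assms(1)]) (auto simp: norm_mult intro!: mult_left_le_one_le)

lemma nn_integral_mult_le_nn_sq:
  assumes [measurable]: "u \<in> borel_measurable lebesgue" "v \<in> borel_measurable lebesgue"
  shows "(\<integral>\<^sup>+x. ennreal (norm (u x * cnj (v x))) \<partial>lebesgue)\<^sup>2 \<le> nn_sq u * nn_sq v"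
  using Cauchy_Schwarz_nn_integral[of "\<lambda>x. ennreal (norm (u x))" lebesgue "\<lambda>x. ennreal (norm (v x))"]
  by (simp add: nn_sq_def norm_mult ennreal_mult ennreal_power)

lemma L2_mult_integrable:
  assumes "u \<in> L2" "v \<in> L2"
  shows "integrable lebesgue (\<lambda>x. u x * cnj (v x))"
proof -
  have [measurable]: "u \<in> borel_measurable lebesgue" "v \<in> borel_measurable lebesgue"
    using assms by auto
  have "nn_sq u * nn_sq v < \<infinity>"
    using assms by (auto simp: L2_iff ennreal_mult_less_top)
  with nn_integral_mult_le_nn_sq[of u v]
  have "(\<integral>\<^sup>+x. ennreal (norm (u x * cnj (v x))) \<partial>lebesgue)\<^sup>2 < \<infinity>"
    by (auto intro: le_less_trans)
  then show ?thesis
    by (auto simp: integrable_iff_bounded power_less_top_ennreal)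
qed

lemma L2_inner_bound:
  assumes "u \<in> L2" "v \<in> L2"
  shows "(ennreal (norm (L2_inner u v)))\<^sup>2 \<le> nn_sq u * nn_sq v"
proof -
  have "ennreal (norm (L2_inner u v)) \<le> (\<integral>\<^sup>+x. ennreal (norm (u x * cnj (v x))) \<partial>lebesgue)"
    unfolding L2_inner_def by (intro integral_norm_bound_ennreal L2_mult_integrable assms)
  then have "(ennreal (norm (L2_inner u v)))\<^sup>2 \<le> (\<integral>\<^sup>+x. ennreal (norm (u x * cnj (v x))) \<partial>lebesgue)\<^sup>2"
    by (intro power_mono) auto
  also have "\<dots> \<le> nn_sq u * nn_sq v"
    using assms by (intro nn_integral_mult_le_nn_sq) auto
  finally show ?thesis .
qed

lemma L2_inner_commute: "L2_inner v u = cnj (L2_inner u v)"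
  unfolding L2_inner_def by (subst Bochner_Integration.integral_cnj[symmetric]) (simp add: mult.commute)

lemma L2_inner_diff_left:
  assumes "u \<in> L2" "v \<in> L2" "w \<in> L2"
  shows "L2_inner (\<lambda>x. u x - v x) w = L2_inner u w - L2_inner v w"
  unfolding L2_inner_def using L2_mult_integrable assms
  by (subst Bochner_Integration.integral_diff[symmetric]) (auto simp: algebra_simps)

lemma L2_inner_self: "L2_inner u u = of_real (LINT x|lebesgue. (norm (u x))\<^sup>2)"
  unfolding L2_inner_def integral_complex_of_real[symmetric]
  by (intro Bochner_Integration.integral_cong) (simp_all add: complex_norm_square del: of_real_power)

lemma nn_sq_eq_inner:
  assumes "u \<in> L2"
  shows "nn_sq u = ennreal (Re (L2_inner u u))"
proof -
  have "nn_sq u = ennreal (LINT x|lebesgue. (norm (u x))\<^sup>2)"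
    unfolding nn_sq_def using assms by (intro nn_integral_eq_integral) (auto simp: L2_def)
  then show ?thesis by (simp add: L2_inner_self)
qed

lemma L2_inner_self_eq_0_AE:
  assumes "u \<in> L2" "L2_inner u u = 0"
  shows "AE x in lebesgue. u x = 0"
proof -
  have "(LINT x|lebesgue. (norm (u x))\<^sup>2) = 0"
    using assms by (simp add: L2_inner_self)
  then show ?thesis
    using assms by (subst (asm) integral_nonneg_eq_0_iff_AE) (auto simp: L2_def)
qed

lemma L2_eqI_AE:
  assumes "u \<in> L2" "v \<in> L2" "\<And>w. w \<in> L2 \<Longrightarrow> L2_inner u w = L2_inner v w"
  shows "AE x in lebesgue. u x = v x"
proof -
  have "L2_inner (\<lambda>x. u x - v x) (\<lambda>x. u x - v x) = 0"
    using assms by (subst L2_inner_diff_left) (auto intro: L2_diff)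
  from L2_inner_self_eq_0_AE[OF L2_diff[OF assms(1,2)] this] show ?thesis
    by simp
qed

lemma L2_inner_cong_AE:
  assumes "u \<in> L2" "u' \<in> L2" "v \<in> L2" "v' \<in> L2"
    and "AE x in lebesgue. u x = u' x" "AE x in lebesgue. v x = v' x"
  shows "L2_inner u v = L2_inner u' v'"
proof -
  have [measurable]: "u \<in> borel_measurable lebesgue" "v \<in> borel_measurable lebesgue"
    "u' \<in> borel_measurable lebesgue" "v' \<in> borel_measurable lebesgue"
    using assms by auto
  show ?thesis
    unfolding L2_inner_def by (intro integral_cong_AE) (use assms(5,6) in auto)
qed

lemma L2_inner_tendsto:
  assumes "L2_tendsto f u" "\<And>n. f n \<in> L2" "u \<in> L2" "v \<in> L2"
  shows "(\<lambda>n. L2_inner (f n) v) \<longlonglongrightarrow> L2_inner u v"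
proof -
  have lim: "(\<lambda>n. nn_sq v * nn_sq (\<lambda>x. f n x - u x)) \<longlonglongrightarrow> nn_sq v * 0"
    using nn_sq_finite[OF assms(4)] assms(1)[unfolded L2_tendsto_iff]
    by (intro ennreal_tendsto_cmult) simp_all
  have "(\<lambda>n. (ennreal (norm (L2_inner (f n) v - L2_inner u v)))\<^sup>2) \<longlonglongrightarrow> 0"
  proof (rule tendsto_sandwich[OF _ _ tendsto_const])
    show "(\<lambda>n. nn_sq (\<lambda>x. f n x - u x) * nn_sq v) \<longlonglongrightarrow> 0"
      using lim by (simp add: mult.commute)
    show "\<forall>\<^sub>F n in sequentially. (ennreal (norm (L2_inner (f n) v - L2_inner u v)))\<^sup>2
        \<le> nn_sq (\<lambda>x. f n x - u x) * nn_sq v"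
      using assms
      by (intro always_eventually allI)
         (subst L2_inner_diff_left[symmetric], auto intro!: L2_inner_bound L2_diff)
  qed auto
  then have "(\<lambda>n. ennreal ((norm (L2_inner (f n) v - L2_inner u v))\<^sup>2)) \<longlonglongrightarrow> 0"
    by (simp add: ennreal_power)
  then have "(\<lambda>n. (norm (L2_inner (f n) v - L2_inner u v))\<^sup>2) \<longlonglongrightarrow> 0"
    by (subst (asm) ennreal_tendsto_0_iff) auto
  from tendsto_real_sqrt[OF this] have "(\<lambda>n. norm (L2_inner (f n) v - L2_inner u v)) \<longlonglongrightarrow> 0"
    by simp
  from LIM_zero_cancel[OF tendsto_norm_zero_cancel[OF this]] show ?thesis .
qed

lemma L2_tendsto_L2_limit:
  assumes "L2_tendsto f u" "\<And>n. f n \<in> L2" "u \<in> borel_measurable lebesgue"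
  shows "u \<in> L2"
proof -
  have "\<forall>\<^sub>F n in sequentially. nn_sq (\<lambda>x. f n x - u x) < 1"
    using assms(1) unfolding L2_tendsto_iff by (rule order_tendstoD) simp
  then obtain n where "nn_sq (\<lambda>x. f n x - u x) < 1"
    by (auto simp: eventually_sequentially)
  then have "nn_sq (\<lambda>x. u x - f n x) \<le> 1"
    by (subst nn_sq_minus_commute) simp
  have "nn_sq u \<le> 2 * (nn_sq (\<lambda>x. u x - f n x) + nn_sq (f n))"
    using nn_sq_triangle[of u "f n" "\<lambda>_. 0"] assms by (auto simp: L2_iff)
  also have "\<dots> \<le> 2 * (1 + nn_sq (f n))"
    by (intro mult_left_mono add_right_mono) (use \<open>nn_sq (\<lambda>x. u x - f n x) \<le> 1\<close> in auto)
  also have "\<dots> < \<infinity>"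
    using nn_sq_finite[OF assms(2)[of n]] by (auto simp: ennreal_mult_less_top)
  finally have "nn_sq u < \<infinity>" .
  then show ?thesis
    using assms by (simp add: L2_iff)
qed

lemma nn_sq_liminf_le:
  assumes "\<And>m. g m \<in> borel_measurable lebesgue" "AE x in lebesgue. (\<lambda>m. g m x) \<longlonglongrightarrow> h x"
  shows "nn_sq h \<le> liminf (\<lambda>m. nn_sq (g m))"
proof -
  have "nn_sq h = (\<integral>\<^sup>+x. liminf (\<lambda>m. ennreal ((norm (g m x))\<^sup>2)) \<partial>lebesgue)"
    unfolding nn_sq_def
  proof (intro nn_integral_cong_AE)
    show "AE x in lebesgue. ennreal ((norm (h x))\<^sup>2) = liminf (\<lambda>m. ennreal ((norm (g m x))\<^sup>2))"
      using assms(2)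
    proof eventually_elim
      case (elim x)
      have "(\<lambda>m. ennreal ((norm (g m x))\<^sup>2)) \<longlonglongrightarrow> ennreal ((norm (h x))\<^sup>2)"
        by (intro tendsto_intros elim)
      then show ?case
        by (intro lim_imp_Liminf[symmetric]) auto
    qed
  qed
  also have "\<dots> \<le> liminf (\<lambda>m. nn_sq (g m))"
    unfolding nn_sq_def by (intro nn_integral_liminf) (use assms(1) in measurable)
  finally show ?thesis .
qed

lemma two_mult_less_ennreal:
  fixes a b :: ennreal
  assumes a: "a < ennreal (e / 4)" and b: "b < ennreal (e / 4)"
  shows "2 * (a + b) < ennreal e"
proof -
  have "0 < ennreal (e / 4)"
    using a by (rule le_less_trans[rotated]) simp
  then have e: "0 < e" by simp
  obtain a' where a': "a = ennreal a'" "0 \<le> a'" "a' < e / 4"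
    using a e by (cases a) (auto simp: ennreal_less_iff)
  obtain b' where b': "b = ennreal b'" "0 \<le> b'" "b' < e / 4"
    using b e by (cases b) (auto simp: ennreal_less_iff)
  have "2 * (a + b) = ennreal (2 * (a' + b'))"
    using a' b' by (subst ennreal_mult) (auto simp: ennreal_plus)
  also have "\<dots> < ennreal e"
    using a' b' e by (intro ennreal_lessI) auto
  finally show ?thesis .
qed

section \<open>The Fourier integral of an integrable function\<close>

lemma sigma_finite_lebesgue: "sigma_finite_measure (lebesgue :: 'a::euclidean_space measure)"
proof
  show "\<exists>A. countable A \<and> A \<subseteq> sets lebesgue \<and> \<Union>A = space (lebesgue :: 'a measure) \<and>
      (\<forall>a\<in>A. emeasure lebesgue a \<noteq> \<infinity>)"
  proof (intro exI[of _ "range (\<lambda>n. ball (0::'a) (real n))"] conjI ballI)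
    show "\<Union> (range (\<lambda>n. ball (0::'a) (real n))) = space lebesgue"
      by (auto simp: dist_norm reals_Archimedean2)
    fix a assume "a \<in> range (\<lambda>n. ball (0::'a) (real n))"
    then obtain n where a: "a = ball 0 (real n)" by auto
    have "emeasure lborel a < \<infinity>"
      unfolding a by (intro emeasure_bounded_finite bounded_ball)
    then show "emeasure lebesgue a \<noteq> \<infinity>"
      by (simp add: a)
  qed auto
qed

interpretation lebesgue_pair: pair_sigma_finite "lebesgue :: 'a::euclidean_space measure" "lebesgue :: 'b::euclidean_space measure"
  by (simp add: pair_sigma_finite_def sigma_finite_lebesgue)

text \<open>
  The kernel \<open>exp (- 2 \<pi> i \<xi> \<cdot> x)\<close> of the Fourier transform.
\<close>

abbreviation fourier_kernel :: "'a::euclidean_space \<Rightarrow> 'a \<Rightarrow> complex" where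
  "fourier_kernel \<xi> x \<equiv> exp (- (2 * of_real pi * \<i> * of_real (\<xi> \<bullet> x)))"

lemma norm_fourier_kernel [simp]: "norm (fourier_kernel \<xi> x) = 1"
  by simp

lemma borel_measurable_continuous_lebesgue:
  "continuous_on UNIV f \<Longrightarrow> f \<in> borel_measurable lebesgue"
  by (intro measurable_completion) (simp add: borel_measurable_continuous_onI)

lemma measurable_fourier_kernel [measurable]: "fourier_kernel \<xi> \<in> borel_measurable lebesgue"
  by (intro borel_measurable_continuous_lebesgue continuous_intros)

lemma integrable_unimodular_mult:
  fixes u :: "'a::euclidean_space \<Rightarrow> complex"
  assumes "integrable lebesgue u" "w \<in> borel_measurable lebesgue" "\<And>x. norm (w x) = 1"
  shows "integrable lebesgue (\<lambda>x. w x * u x)"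
proof -
  have [measurable]: "u \<in> borel_measurable lebesgue" "w \<in> borel_measurable lebesgue"
    using assms by auto
  show ?thesis
    by (rule Bochner_Integration.integrable_bound[OF assms(1)]) (auto simp: norm_mult assms(3))
qed

lemma integrable_fourier_kernel_mult:
  "integrable lebesgue u \<Longrightarrow> integrable lebesgue (\<lambda>x. fourier_kernel \<xi> x * u x)"
  by (intro integrable_unimodular_mult) (auto simp del: norm_exp_eq_Re)

lemma fourier_integral_diff:
  assumes "integrable lebesgue f" "integrable lebesgue g"
  shows "fourier_integral (\<lambda>x. f x - g x) \<xi> = fourier_integral f \<xi> - fourier_integral g \<xi>"
  unfolding fourier_integral_def
  using assms[THEN integrable_fourier_kernel_mult[where \<xi> = \<xi>]]
  by (subst Bochner_Integration.integral_diff[symmetric]) (auto simp: algebra_simps)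

lemma norm_fourier_integral_le:
  assumes "integrable lebesgue f"
  shows "norm (fourier_integral f \<xi>) \<le> (LINT x|lebesgue. norm (f x))"
  using integral_norm_bound[of lebesgue "\<lambda>x. fourier_kernel \<xi> x * f x"]
  by (simp add: fourier_integral_def norm_mult)

lemma continuous_on_fourier_integral:
  assumes "integrable lebesgue f"
  shows "continuous_on UNIV (fourier_integral f)"
proof (clarsimp simp: continuous_on_eq_continuous_at continuous_at_sequentially o_def)
  fix \<xi> :: 'a and X :: "nat \<Rightarrow> 'a" assume X: "X \<longlonglongrightarrow> \<xi>"
  have [measurable]: "f \<in> borel_measurable lebesgue" using assms by auto
  show "(\<lambda>n. fourier_integral f (X n)) \<longlonglongrightarrow> fourier_integral f \<xi>"
    unfolding fourier_integral_def
  proof (rule integral_dominated_convergence[where w = "\<lambda>x. norm (f x)"])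
    show "AE x in lebesgue. (\<lambda>n. fourier_kernel (X n) x * f x) \<longlonglongrightarrow> fourier_kernel \<xi> x * f x"
      by (intro AE_I2 tendsto_intros X)
  qed (use assms in \<open>auto simp: norm_mult\<close>)
qed

lemma measurable_fourier_integral:
  "integrable lebesgue f \<Longrightarrow> fourier_integral f \<in> borel_measurable lebesgue"
  by (intro borel_measurable_continuous_lebesgue continuous_on_fourier_integral)

lemma integrable_mult_bounded:
  fixes u v :: "'a::euclidean_space \<Rightarrow> complex"
  assumes "integrable lebesgue u" "v \<in> borel_measurable lebesgue" "\<And>x. norm (v x) \<le> B"
  shows "integrable lebesgue (\<lambda>x. u x * v x)"
proof -
  have [measurable]: "u \<in> borel_measurable lebesgue" "v \<in> borel_measurable lebesgue"
    using assms by auto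
  have bound: "norm (u x * v x) \<le> norm (B * norm (u x))" for x
  proof -
    have "norm (u x * v x) \<le> norm (u x) * B"
      unfolding norm_mult by (intro mult_left_mono assms) auto
    then show ?thesis by (simp add: mult.commute)
  qed
  show ?thesis
  proof (rule Bochner_Integration.integrable_bound)
    show "integrable lebesgue (\<lambda>x. B * norm (u x))"
      using assms(1) by simp
    show "AE x in lebesgue. norm (u x * v x) \<le> norm (B * norm (u x))"
      using bound by simp
  qed simp
qed

text \<open>
  By Fubini's theorem, as the kernel is symmetric. It is applied on the product of the
  Lebesgue measure with itself (not completed): there the kernel is measurable, because it is
  Borel, and so are products of functions of one variable.
\<close>

lemma fourier_multiplication_formula:
  fixes u v :: "'a::euclidean_space \<Rightarrow> complex"
  assumes u: "integrable lebesgue u" and v: "integrable lebesgue v"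
  shows "(LINT \<xi>|lebesgue. fourier_integral u \<xi> * v \<xi>) = (LINT x|lebesgue. u x * fourier_integral v x)"
proof -
  have [measurable]: "u \<in> borel_measurable lebesgue" "v \<in> borel_measurable lebesgue"
    using u v by auto
  have [measurable]: "(\<lambda>(x, \<xi>). fourier_kernel \<xi> x) \<in> borel_measurable (lebesgue \<Otimes>\<^sub>M (lebesgue :: 'a measure))"
  proof -
    have id: "(\<lambda>x::'a. x) \<in> lebesgue \<rightarrow>\<^sub>M borel"
      by (simp add: borel_measurable_continuous_lebesgue)
    have "(\<lambda>p::'a \<times> 'a. (fst p, snd p)) \<in> lebesgue \<Otimes>\<^sub>M (lebesgue :: 'a measure) \<rightarrow>\<^sub>M borel \<Otimes>\<^sub>M borel"
      by (rule measurable_Pair)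
        (rule measurable_compose[OF measurable_fst id], rule measurable_compose[OF measurable_snd id])
    moreover have "(\<lambda>p. fourier_kernel (snd p) (fst p)) \<in> borel_measurable (borel \<Otimes>\<^sub>M (borel :: 'a measure))"
      by measurable
    ultimately have "(\<lambda>p. fourier_kernel (snd (fst p, snd p)) (fst (fst p, snd p)))
        \<in> borel_measurable (lebesgue \<Otimes>\<^sub>M (lebesgue :: 'a measure))"
      by (rule measurable_compose)
    then show ?thesis
      by (simp only: split_beta' fst_conv snd_conv)
  qed
  define F where "F x \<xi> = fourier_kernel \<xi> x * (u x * v \<xi>)" for x \<xi>
  have F[measurable]: "(\<lambda>(x, \<xi>). F x \<xi>) \<in> borel_measurable (lebesgue \<Otimes>\<^sub>M lebesgue)"
    unfolding F_def by measurable
  have "integrable (lebesgue \<Otimes>\<^sub>M lebesgue) (\<lambda>(x, \<xi>). F x \<xi>)"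
  proof (rule lebesgue_pair.Fubini_integrable)
    have "(\<lambda>x. LINT \<xi>|lebesgue. norm (F x \<xi>)) = (\<lambda>x. norm (u x) * (LINT \<xi>|lebesgue. norm (v \<xi>)))"
      by (simp add: F_def norm_mult)
    then show "integrable lebesgue (\<lambda>x. LINT \<xi>|lebesgue. norm (case (x, \<xi>) of (x, \<xi>) \<Rightarrow> F x \<xi>))"
      using u by simp
    have "integrable lebesgue (F x)" for x
      using integrable_mult_right[of "u x", OF integrable_fourier_kernel_mult[OF v, of x]]
      unfolding F_def by (simp add: inner_commute ac_simps)
    then show "AE x in lebesgue. integrable lebesgue (\<lambda>\<xi>. case (x, \<xi>) of (x, \<xi>) \<Rightarrow> F x \<xi>)"
      by simp
  qed simp
  from lebesgue_pair.Fubini_integral[OF this]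
  have "(LINT \<xi>|lebesgue. LINT x|lebesgue. F x \<xi>) = (LINT x|lebesgue. LINT \<xi>|lebesgue. F x \<xi>)" .
  moreover have "(LINT x|lebesgue. F x \<xi>) = fourier_integral u \<xi> * v \<xi>" for \<xi>
    unfolding fourier_integral_def F_def
    by (subst Bochner_Integration.integral_mult_left_zero[symmetric]) (simp add: mult.assoc)
  moreover have "(LINT \<xi>|lebesgue. F x \<xi>) = u x * fourier_integral v x" for x
    unfolding fourier_integral_def F_def
    by (subst Bochner_Integration.integral_mult_right_zero[symmetric]) (simp add: inner_commute ac_simps)
  ultimately show ?thesis by simp
qed

text \<open>
  Through this identity, every property of the inverse transform follows from one of the
  Fourier transform.
\<close>

lemma inv_fourier_integral_eq: "inv_fourier_integral u x = cnj (fourier_integral (\<lambda>x. cnj (u x)) x)"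
  unfolding inv_fourier_integral_def fourier_integral_def
  by (subst Bochner_Integration.integral_cnj[symmetric]) (simp add: exp_cnj)

text \<open>
  A product on the frequency side is a convolution on the other side. This is the
  multiplication formula for \<open>g\<close> and the conjugate of \<open>h\<close> modulated by \<open>exp (- 2 \<pi> i x \<cdot> \<xi>)\<close>.
\<close>

lemma fourier_integral_mult_cnj_fourier_integral:
  fixes g h :: "'a::euclidean_space \<Rightarrow> complex"
  assumes g: "integrable lebesgue g" and h: "integrable lebesgue h"
  shows "fourier_integral (\<lambda>\<xi>. h \<xi> * cnj (fourier_integral g \<xi>)) x =
    (LINT y|lebesgue. cnj (g y) * fourier_integral h (x - y))"
proof -
  define w where "w \<xi> = cnj (fourier_kernel x \<xi> * h \<xi>)" for \<xi>
  have w: "integrable lebesgue w"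
    unfolding w_def using integrable_fourier_kernel_mult[OF h, of x]
    by (simp del: complex_cnj_mult)
  have eq: "cnj (fourier_integral w y) = fourier_integral h (x - y)" for y
  proof -
    have "cnj (fourier_kernel y \<xi> * cnj (fourier_kernel x \<xi>)) = fourier_kernel (x - y) \<xi>" for \<xi>
      by (simp add: exp_cnj mult_exp_exp inner_diff_left right_diff_distrib)
    then have "cnj (fourier_kernel y \<xi> * w \<xi>) = fourier_kernel (x - y) \<xi> * h \<xi>" for \<xi>
      unfolding w_def by (metis complex_cnj_cnj complex_cnj_mult mult.assoc)
    then show ?thesis
      unfolding fourier_integral_def by (subst Bochner_Integration.integral_cnj[symmetric]) simp
  qed
  have "fourier_integral (\<lambda>\<xi>. h \<xi> * cnj (fourier_integral g \<xi>)) x =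
      cnj (LINT \<xi>|lebesgue. fourier_integral g \<xi> * w \<xi>)"
    unfolding w_def fourier_integral_def[of "\<lambda>\<xi>. h \<xi> * cnj (fourier_integral g \<xi>)"]
    by (subst Bochner_Integration.integral_cnj[symmetric]) (simp add: ac_simps)
  also have "\<dots> = (LINT y|lebesgue. cnj (g y) * cnj (fourier_integral w y))"
    unfolding fourier_multiplication_formula[OF g w]
    by (subst Bochner_Integration.integral_cnj[symmetric]) simp
  finally show ?thesis
    by (simp add: eq)
qed

section \<open>Gaussians and their Fourier transforms\<close>

text \<open>
  Fubini's theorem for products of functions of one coordinate.
\<close>

lemma
  fixes h :: "'a::euclidean_space \<Rightarrow> real \<Rightarrow> complex"
  assumes h: "\<And>b. b \<in> Basis \<Longrightarrow> integrable lborel (h b)"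
  shows integrable_prod_Basis: "integrable lborel (\<lambda>x::'a. \<Prod>b\<in>Basis. h b (x \<bullet> b))"
    and integral_prod_Basis:
      "(LINT x|lborel. (\<Prod>b\<in>Basis. h b (x \<bullet> b))) = (\<Prod>b\<in>Basis. LINT t|lborel. h b t)"
proof -
  interpret product_sigma_finite "\<lambda>_::'a. lborel :: real measure"
    by unfold_locales
  let ?T = "\<lambda>f. \<Sum>b\<in>Basis. f b *\<^sub>R (b::'a)"
  let ?P = "Pi\<^sub>M Basis (\<lambda>_::'a. lborel :: real measure)"
  have T: "?T \<in> ?P \<rightarrow>\<^sub>M borel"
    by measurable
  have coord: "?T f \<bullet> c = f c" if "c \<in> Basis" for f c
    using that by (simp add: inner_sum_left inner_Basis if_distrib cong: if_cong)
  have m: "(\<lambda>x. \<Prod>b\<in>Basis. h b (x \<bullet> b)) \<in> borel_measurable borel"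
  proof (rule borel_measurable_prod)
    fix b :: 'a assume "b \<in> Basis"
    then have "h b \<in> borel_measurable borel"
      using h[of b] by (auto dest: borel_measurable_integrable)
    then show "(\<lambda>x. h b (x \<bullet> b)) \<in> borel_measurable borel"
      by (rule measurable_compose[rotated]) simp
  qed
  have eq: "(\<Prod>b\<in>Basis. h b (?T f \<bullet> b)) = (\<Prod>b\<in>Basis. h b (f b))" for f
    by (intro prod.cong refl) (simp only: coord)
  show "integrable lborel (\<lambda>x::'a. \<Prod>b\<in>Basis. h b (x \<bullet> b))"
    by (subst lborel_eq, subst integrable_distr_eq[OF T m], unfold eq)
      (rule product_integrable_prod, auto intro: h)
  show "(LINT x|lborel. (\<Prod>b\<in>Basis. h b (x \<bullet> b))) = (\<Prod>b\<in>Basis. LINT t|lborel. h b t)"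
    by (subst lborel_eq, subst integral_distr[OF T m], unfold eq)
      (rule product_integral_prod, auto intro: h)
qed

text \<open>
  The density of the standard normal distribution on a Euclidean space.
\<close>

definition std_gauss :: "'a::euclidean_space \<Rightarrow> real" where
  "std_gauss x = (\<Prod>b\<in>Basis. std_normal_density (x \<bullet> b))"

lemma std_gauss_nonneg: "0 \<le> std_gauss x"
  by (simp add: std_gauss_def prod_nonneg)

lemma continuous_on_std_gauss: "continuous_on A std_gauss"
  unfolding std_gauss_def[abs_def] normal_density_def
  by (intro continuous_intros) auto

lemma measurable_std_gauss [measurable]: "std_gauss \<in> borel_measurable borel"
  by (intro borel_measurable_continuous_onI continuous_on_std_gauss)

lemma integrable_std_gauss: "integrable lborel (\<lambda>x::'a::euclidean_space. of_real (std_gauss x) :: complex)"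
  and integral_std_gauss: "(LINT x|lborel. (of_real (std_gauss (x::'a)) :: complex)) = 1"
proof -
  have i: "integrable lborel (\<lambda>t. of_real (std_normal_density t) :: complex)"
    by (intro integrable_of_real integrable_normal_density) simp
  have o: "(LINT t|lborel. (of_real (std_normal_density t) :: complex)) = 1"
    by (simp add: integral_complex_of_real integral_normal_density)
  show "integrable lborel (\<lambda>x::'a. of_real (std_gauss x) :: complex)"
    using integrable_prod_Basis[OF i, where 'a = 'a] by (simp add: std_gauss_def)
  show "(LINT x|lborel. (of_real (std_gauss (x::'a)) :: complex)) = 1"
    using integral_prod_Basis[OF i, where 'a = 'a] o by (simp add: std_gauss_def)
qed

text \<open>
  This is the characteristic function of the normal distribution, rescaled.
\<close>

lemma fourier_gauss_1d:
  fixes \<epsilon> z :: real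
  assumes "0 < \<epsilon>"
  shows "integrable lborel (\<lambda>t. exp (- (2 * of_real pi * \<i> * of_real (z * t))) * of_real (exp (- (\<epsilon> * t)\<^sup>2 / 2)))"
    and "(LINT t|lborel. exp (- (2 * of_real pi * \<i> * of_real (z * t))) * of_real (exp (- (\<epsilon> * t)\<^sup>2 / 2))) =
      of_real (2 * pi / \<epsilon> * std_normal_density (2 * pi / \<epsilon> * z))"
proof -
  define \<tau> where "\<tau> = - (2 * pi * z / \<epsilon>)"
  define G where "G t = of_real (std_normal_density t) * iexp (\<tau> * t)" for t
  define H where "H t = exp (- (2 * of_real pi * \<i> * of_real (z * t))) * of_real (exp (- (\<epsilon> * t)\<^sup>2 / 2))" for t
  have GH: "G (0 + \<epsilon> * t) = of_real (1 / sqrt (2 * pi)) * H t" for t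
  proof -
    have "\<i> * complex_of_real (\<tau> * (\<epsilon> * t)) = - (2 * of_real pi * \<i> * of_real (z * t))"
      using assms by (simp add: \<tau>_def)
    then show ?thesis
      by (simp add: G_def H_def std_normal_density_def)
  qed
  have "integrable lborel (\<lambda>t. of_real (std_normal_density t) :: complex)"
    by (intro integrable_of_real integrable_normal_density) simp
  then have G: "integrable lborel G"
    by (rule Bochner_Integration.integrable_bound) (auto simp: G_def[abs_def] norm_mult)
  have "integrable lborel (\<lambda>t. G (0 + \<epsilon> * t))"
    using lborel_integrable_real_affine[OF G, of \<epsilon> 0] assms by simp
  then have "integrable lborel (\<lambda>t. of_real (sqrt (2 * pi)) * G (0 + \<epsilon> * t))"
    by (rule integrable_mult_right)
  moreover have "of_real (sqrt (2 * pi)) * G (0 + \<epsilon> * t) = H t" for t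
    unfolding GH by simp
  ultimately have "integrable lborel H"
    by simp
  then show "integrable lborel (\<lambda>t. exp (- (2 * of_real pi * \<i> * of_real (z * t))) * of_real (exp (- (\<epsilon> * t)\<^sup>2 / 2)))"
    by (simp only: H_def[abs_def])
  have "complex_of_real (exp (- \<tau>\<^sup>2 / 2)) = (LINT t|lborel. G t)"
    using fun_cong[OF char_std_normal_distribution, of \<tau>] unfolding char_def G_def
    by (subst (asm) integral_density) (auto simp: scaleR_conv_of_real)
  also have "\<dots> = \<bar>\<epsilon>\<bar> *\<^sub>R (LINT t|lborel. G (0 + \<epsilon> * t))"
    using assms by (intro lborel_integral_real_affine) simp
  also have "\<dots> = of_real (\<epsilon> / sqrt (2 * pi)) * (LINT t|lborel. H t)"
    unfolding GH using assms by (simp add: scaleR_conv_of_real)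
  finally have "(LINT t|lborel. H t) = of_real (sqrt (2 * pi) / \<epsilon> * exp (- \<tau>\<^sup>2 / 2))"
    using assms by (simp add: field_simps)
  also have "sqrt (2 * pi) / \<epsilon> * exp (- \<tau>\<^sup>2 / 2) = 2 * pi / \<epsilon> * std_normal_density (2 * pi / \<epsilon> * z)"
    using assms by (simp add: std_normal_density_def \<tau>_def field_simps)
  finally show "(LINT t|lborel. exp (- (2 * of_real pi * \<i> * of_real (z * t))) * of_real (exp (- (\<epsilon> * t)\<^sup>2 / 2))) =
      of_real (2 * pi / \<epsilon> * std_normal_density (2 * pi / \<epsilon> * z))"
    by (simp only: H_def)
qed

text \<open>
  The Gaussian factor that makes integrals over frequencies converge. It increases to \<open>1\<close> as
  \<open>\<epsilon>\<close> decreases to \<open>0\<close>, while its Fourier transform is the standard normal density shrunk by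
  the factor \<open>2 * pi / \<epsilon>\<close>, hence an approximate identity.
\<close>

definition gauss_damping :: "real \<Rightarrow> 'a::euclidean_space \<Rightarrow> real" where
  "gauss_damping \<epsilon> \<xi> = exp (- (\<epsilon> * norm \<xi>)\<^sup>2 / 2)"

lemma continuous_on_gauss_damping: "continuous_on A (gauss_damping \<epsilon>)"
  unfolding gauss_damping_def[abs_def] by (intro continuous_intros) auto

lemma measurable_gauss_damping [measurable]: "gauss_damping \<epsilon> \<in> borel_measurable borel"
  by (intro borel_measurable_continuous_onI continuous_on_gauss_damping)

lemma measurable_gauss_damping_lebesgue [measurable]: "gauss_damping \<epsilon> \<in> borel_measurable lebesgue"
  by (intro borel_measurable_continuous_lebesgue continuous_on_gauss_damping)

lemma gauss_damping_pos: "0 < gauss_damping \<epsilon> \<xi>"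
  and gauss_damping_le_1: "gauss_damping \<epsilon> \<xi> \<le> 1"
  by (simp_all add: gauss_damping_def)

lemma
  fixes z :: "'a::euclidean_space"
  assumes "0 < \<epsilon>"
  shows integrable_gauss_damping: "integrable lebesgue (\<lambda>\<xi>::'a. of_real (gauss_damping \<epsilon> \<xi>) :: complex)"
    and fourier_gauss_damping: "fourier_integral (\<lambda>\<xi>. of_real (gauss_damping \<epsilon> \<xi>)) z =
      of_real ((2 * pi / \<epsilon>) ^ DIM('a) * std_gauss ((2 * pi / \<epsilon>) *\<^sub>R z))"
proof -
  define h where "h z b t = exp (- (2 * of_real pi * \<i> * of_real ((z \<bullet> b) * t))) * complex_of_real (exp (- (\<epsilon> * t)\<^sup>2 / 2))"
    for z b :: 'a and t :: real
  have hi: "integrable lborel (h z b)" for z b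
    unfolding h_def by (rule fourier_gauss_1d(1)[OF assms])
  have prod: "(\<Prod>b\<in>Basis. h z b (\<xi> \<bullet> b)) = fourier_kernel z \<xi> * of_real (gauss_damping \<epsilon> \<xi>)" for z \<xi>
  proof -
    have "(\<Prod>b\<in>Basis. exp (- (2 * of_real pi * \<i> * of_real ((z \<bullet> b) * (\<xi> \<bullet> b))))) = fourier_kernel z \<xi>"
      by (subst euclidean_inner, subst exp_sum[symmetric]) (simp_all add: sum_negf sum_distrib_left)
    moreover have "(\<Prod>b\<in>Basis. complex_of_real (exp (- (\<epsilon> * (\<xi> \<bullet> b))\<^sup>2 / 2))) = of_real (gauss_damping \<epsilon> \<xi>)"
    proof -
      have "(\<Prod>b\<in>Basis. exp (- (\<epsilon> * (\<xi> \<bullet> b))\<^sup>2 / 2)) = exp (\<Sum>b\<in>Basis. - (\<epsilon> * (\<xi> \<bullet> b))\<^sup>2 / 2)"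
        by (rule exp_sum[symmetric]) simp
      also have "(\<Sum>b\<in>Basis. - (\<epsilon> * (\<xi> \<bullet> b))\<^sup>2 / 2) = - (\<epsilon> * norm \<xi>)\<^sup>2 / 2"
      proof -
        have "(norm \<xi>)\<^sup>2 = (\<Sum>b\<in>Basis. (\<xi> \<bullet> b)\<^sup>2)"
          by (subst power2_norm_eq_inner, subst euclidean_inner) (simp add: power2_eq_square)
        then show ?thesis
          by (simp add: power_mult_distrib sum_negf sum_divide_distrib sum_distrib_left)
      qed
      finally show ?thesis
        by (simp only: gauss_damping_def of_real_prod[symmetric])
    qed
    ultimately show ?thesis
      by (simp only: h_def prod.distrib)
  qed
  have m: "(\<lambda>\<xi>. fourier_kernel z \<xi> * of_real (gauss_damping \<epsilon> \<xi>)) \<in> borel_measurable lborel" for z :: 'a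
    by measurable
  show "integrable lebesgue (\<lambda>\<xi>::'a. of_real (gauss_damping \<epsilon> \<xi>) :: complex)"
    using integrable_prod_Basis[of "h 0", OF hi] integrable_completion[OF m[of 0]] by (simp add: prod)
  have "fourier_integral (\<lambda>\<xi>. of_real (gauss_damping \<epsilon> \<xi>)) z =
      (LINT \<xi>|lborel. (\<Prod>b\<in>Basis. h z b (\<xi> \<bullet> b)))"
    unfolding fourier_integral_def prod by (rule integral_completion[OF m])
  also have "\<dots> = (\<Prod>b\<in>Basis. of_real (2 * pi / \<epsilon> * std_normal_density (2 * pi / \<epsilon> * (z \<bullet> b))))"
    unfolding integral_prod_Basis[OF hi] unfolding h_def fourier_gauss_1d(2)[OF assms] ..
  also have "\<dots> = of_real ((2 * pi / \<epsilon>) ^ DIM('a) * std_gauss ((2 * pi / \<epsilon>) *\<^sub>R z))"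
    by (simp only: of_real_prod[symmetric] prod.distrib prod_constant std_gauss_def inner_scaleR_left)
  finally show "fourier_integral (\<lambda>\<xi>. of_real (gauss_damping \<epsilon> \<xi>)) z =
      of_real ((2 * pi / \<epsilon>) ^ DIM('a) * std_gauss ((2 * pi / \<epsilon>) *\<^sub>R z))" .
qed

lemma lborel_integral_affine:
  fixes G :: "'a::euclidean_space \<Rightarrow> complex"
  assumes [measurable]: "G \<in> borel_measurable borel" and c: "c \<noteq> 0"
  shows "(LINT y|lborel. G y) = \<bar>c\<bar> ^ DIM('a) *\<^sub>R (LINT t|lborel. G (x + c *\<^sub>R t))"
  by (subst lborel_affine[OF c, of x]) (simp add: integral_density integral_distr)

lemma gauss_convolution:
  fixes k :: "'a::euclidean_space \<Rightarrow> complex"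
  assumes [measurable]: "k \<in> borel_measurable borel" and c: "0 < c"
  shows "(LINT y|lborel. k y * of_real (c ^ DIM('a) * std_gauss (c *\<^sub>R (x - y)))) =
    (LINT t|lborel. k (x - (1 / c) *\<^sub>R t) * of_real (std_gauss t))"
proof -
  have "(LINT y|lborel. k y * of_real (c ^ DIM('a) * std_gauss (c *\<^sub>R (x - y)))) =
    \<bar>- 1 / c\<bar> ^ DIM('a) *\<^sub>R (LINT t|lborel. k (x + (- 1 / c) *\<^sub>R t) *
      of_real (c ^ DIM('a) * std_gauss (c *\<^sub>R (x - (x + (- 1 / c) *\<^sub>R t)))))"
    using c by (intro lborel_integral_affine) auto
  also have "\<dots> = \<bar>- 1 / c\<bar> ^ DIM('a) *\<^sub>R (LINT t|lborel. of_real (c ^ DIM('a)) * (k (x - (1 / c) *\<^sub>R t) * of_real (std_gauss t)))"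
    using c by (simp add: ac_simps)
  also have "\<dots> = (LINT t|lborel. k (x - (1 / c) *\<^sub>R t) * of_real (std_gauss t))"
    using c by (simp add: scaleR_conv_of_real power_divide)
  finally show ?thesis .
qed

section \<open>Parseval's identity for bounded continuous integrable functions\<close>

text \<open>
  Bounded continuous integrable functions. For them a mollification converges pointwise and
  boundedly, so that no continuity of translations in \<open>L\<^sub>2\<close> is needed.
\<close>

definition bcont_L1 :: "('a::euclidean_space \<Rightarrow> complex) set" where
  "bcont_L1 = {f. continuous_on UNIV f \<and> bounded (range f) \<and> integrable lebesgue f}"

lemma bcont_L1_diff: "f \<in> bcont_L1 \<Longrightarrow> g \<in> bcont_L1 \<Longrightarrow> (\<lambda>x. f x - g x) \<in> bcont_L1"
  by (auto simp: bcont_L1_def intro!: continuous_intros bounded_minus_comp)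

lemma bcont_L1_bound:
  assumes "f \<in> bcont_L1" obtains B where "0 < B" "\<And>x. norm (f x) \<le> B"
  using assms by (auto simp: bcont_L1_def bounded_pos)

lemma bcont_L1_L2:
  assumes "f \<in> bcont_L1" shows "f \<in> L2"
proof -
  obtain B where B: "0 < B" "\<And>x. norm (f x) \<le> B" using bcont_L1_bound[OF assms] by blast
  have f: "integrable lebesgue f" using assms by (simp add: bcont_L1_def)
  then have [measurable]: "f \<in> borel_measurable lebesgue" by auto
  have "integrable lebesgue (\<lambda>x. f x * f x)"
    using integrable_mult_bounded[OF f _ B(2)] by simp
  then have "integrable lebesgue (\<lambda>x. norm (f x * f x))" by (rule integrable_norm)
  then show ?thesis by (simp add: L2_def norm_mult power2_eq_square)
qed

lemma integrable_fourier_mult_damping: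
  fixes f :: "'a::euclidean_space \<Rightarrow> complex"
  assumes f: "integrable lebesgue f" and \<epsilon>: "0 < \<epsilon>"
  shows "integrable lebesgue (\<lambda>\<xi>. of_real (gauss_damping \<epsilon> \<xi>) * cnj (fourier_integral f \<xi>))"
  using measurable_fourier_integral[OF f] norm_fourier_integral_le[OF f]
  by (intro integrable_mult_bounded[OF integrable_gauss_damping[OF \<epsilon>]]) auto

text \<open>
  The damped pairing of \<open>fourier_integral f\<close> and \<open>fourier_integral g\<close> equals the pairing of \<open>f\<close> with
  the mollification \<open>m n\<close> of \<open>cnj g\<close> by a Gaussian, and the latter tends to \<open>cnj g\<close>.
\<close>

lemma damped_parseval_tendsto:
  fixes f g :: "'a::euclidean_space \<Rightarrow> complex"
  assumes f: "f \<in> bcont_L1" and g: "g \<in> bcont_L1"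
  shows "(\<lambda>n. LINT \<xi>|lebesgue. fourier_integral f \<xi> *
      (of_real (gauss_damping (1 / real (Suc n)) \<xi>) * cnj (fourier_integral g \<xi>))) \<longlonglongrightarrow> L2_inner f g"
proof -
  define m where "m n = fourier_integral (\<lambda>\<xi>. of_real (gauss_damping (1 / real (Suc n)) \<xi>) * cnj (fourier_integral g \<xi>))" for n
  \<comment> \<open>the shrinking factor \<open>2 * pi / \<epsilon>\<close> for \<open>\<epsilon> = 1 / (n + 1)\<close>\<close>
  define c where "c n = 2 * pi * real (Suc n)" for n
  have c: "0 < c n" for n by (simp add: c_def)
  have fi: "integrable lebesgue f" and gi: "integrable lebesgue g"
    and fc: "continuous_on UNIV f" and gc: "continuous_on UNIV g"
    using f g by (auto simp: bcont_L1_def)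
  have gm: "(\<lambda>x. cnj (g x)) \<in> borel_measurable borel"
    by (intro borel_measurable_continuous_onI continuous_intros gc)
  have [measurable]: "f \<in> borel_measurable lebesgue" "g \<in> borel_measurable lebesgue"
    using fi gi by auto
  obtain B where B: "0 < B" "\<And>x. norm (g x) \<le> B" using bcont_L1_bound[OF g] by blast
  have di: "integrable lebesgue (\<lambda>\<xi>. of_real (gauss_damping (1 / real (Suc n)) \<xi>) * cnj (fourier_integral g \<xi>))" for n
    by (intro integrable_fourier_mult_damping gi) simp
  have m_eq: "m n x = (LINT t|lborel. cnj (g (x - (1 / c n) *\<^sub>R t)) * of_real (std_gauss t))" for n x
  proof -
    have "m n x = (LINT y|lebesgue. cnj (g y) * fourier_integral (\<lambda>\<xi>. of_real (gauss_damping (1 / real (Suc n)) \<xi>)) (x - y))"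
      unfolding m_def by (intro fourier_integral_mult_cnj_fourier_integral gi integrable_gauss_damping) simp
    also have "\<dots> = (LINT y|lebesgue. cnj (g y) * of_real (c n ^ DIM('a) * std_gauss (c n *\<^sub>R (x - y))))"
      by (subst fourier_gauss_damping) (simp_all add: c_def)
    also have "\<dots> = (LINT y|lborel. cnj (g y) * of_real (c n ^ DIM('a) * std_gauss (c n *\<^sub>R (x - y))))"
      by (intro integral_completion) (use gm in measurable)
    also have "\<dots> = (LINT t|lborel. cnj (g (x - (1 / c n) *\<^sub>R t)) * of_real (std_gauss t))"
      by (rule gauss_convolution[OF gm c])
    finally show ?thesis .
  qed
  have dom: "norm (cnj (g (x - (1 / c n) *\<^sub>R t)) * of_real (std_gauss t)) \<le> B * std_gauss t" for n x t
    using B(2) by (auto simp: norm_mult std_gauss_nonneg intro!: mult_right_mono)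
  have sgi: "integrable lborel (std_gauss :: 'a \<Rightarrow> real)" and sgo: "(LINT t|lborel. std_gauss (t::'a)) = 1"
    using integrable_std_gauss[where 'a = 'a] integral_std_gauss[where 'a = 'a]
    by (simp_all add: complex_of_real_integrable_eq integral_complex_of_real)
  have gm': "(\<lambda>t. cnj (g (x - (1 / c n) *\<^sub>R t)) * of_real (std_gauss t)) \<in> borel_measurable lborel" for n x
  proof -
    have "(\<lambda>t. cnj (g (x - (1 / c n) *\<^sub>R t))) \<in> borel_measurable borel"
      by (rule measurable_compose[OF _ gm]) simp
    then show ?thesis by measurable
  qed
  have m_lim: "(\<lambda>n. m n x) \<longlonglongrightarrow> cnj (g x)" for x
  proof -
    have clim: "(\<lambda>n. 1 / c n) \<longlonglongrightarrow> 0"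
    proof -
      have "(\<lambda>n. (1 / (2 * pi)) * (1 / real (Suc n))) \<longlonglongrightarrow> (1 / (2 * pi)) * 0"
        by (intro tendsto_mult tendsto_const) (rule LIMSEQ_Suc[OF lim_1_over_n])
      then show ?thesis by (simp add: c_def)
    qed
    have "(\<lambda>n. LINT t|lborel. cnj (g (x - (1 / c n) *\<^sub>R t)) * of_real (std_gauss t)) \<longlonglongrightarrow>
        (LINT t|lborel. cnj (g x) * of_real (std_gauss (t::'a)))"
    proof (rule integral_dominated_convergence[where w = "\<lambda>t. B * std_gauss t"])
      show "AE t in lborel. (\<lambda>n. cnj (g (x - (1 / c n) *\<^sub>R t)) * of_real (std_gauss t)) \<longlonglongrightarrow> cnj (g x) * of_real (std_gauss t)"
      proof (rule AE_I2)
        fix t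
        have "(\<lambda>n. x - (1 / c n) *\<^sub>R t) \<longlonglongrightarrow> x - 0 *\<^sub>R t"
          by (intro tendsto_intros clim)
        then have "(\<lambda>n. g (x - (1 / c n) *\<^sub>R t)) \<longlonglongrightarrow> g x"
          by (intro continuous_on_tendsto_compose[OF gc]) simp_all
        then show "(\<lambda>n. cnj (g (x - (1 / c n) *\<^sub>R t)) * of_real (std_gauss t)) \<longlonglongrightarrow> cnj (g x) * of_real (std_gauss t)"
          by (intro tendsto_intros)
      qed
    qed (use sgi dom gm' in auto)
    then show ?thesis
      using integral_std_gauss[where 'a = 'a] by (simp add: m_eq)
  qed
  have m_bound: "norm (m n x) \<le> B" for n x
  proof -
    have "norm (m n x) \<le> (LINT t|lborel. B * std_gauss (t::'a))"
      unfolding m_eq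
    proof (rule Bochner_Integration.integral_norm_bound_integral)
      show "integrable lborel (\<lambda>t. cnj (g (x - (1 / c n) *\<^sub>R t)) * of_real (std_gauss t))"
      proof (rule Bochner_Integration.integrable_bound)
        show "integrable lborel (\<lambda>t::'a. B * std_gauss t)"
          using sgi by simp
        have "norm (B * std_gauss t) = B * std_gauss t" for t :: 'a
          using B(1) std_gauss_nonneg[of t] by (simp add: abs_mult)
        with dom[of x n] show "AE t in lborel. norm (cnj (g (x - (1 / c n) *\<^sub>R t)) * of_real (std_gauss t))
            \<le> norm (B * std_gauss t)"
          by simp
      qed (rule gm')
    qed (use dom sgi in auto)
    then show ?thesis using sgo by simp
  qed
  have "(\<lambda>n. LINT x|lebesgue. f x * m n x) \<longlonglongrightarrow> (LINT x|lebesgue. f x * cnj (g x))"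
  proof (rule integral_dominated_convergence[where w = "\<lambda>x. B * norm (f x)"])
    show "AE x in lebesgue. (\<lambda>n. f x * m n x) \<longlonglongrightarrow> f x * cnj (g x)"
      by (intro AE_I2 tendsto_intros m_lim)
    show "AE x in lebesgue. norm (f x * m n x) \<le> B * norm (f x)" for n
      using m_bound by (auto simp: norm_mult mult.commute[of B] intro!: mult_left_mono)
    show "(\<lambda>x. f x * m n x) \<in> borel_measurable lebesgue" for n
    proof -
      have [measurable]: "m n \<in> borel_measurable lebesgue"
        unfolding m_def by (intro measurable_fourier_integral di)
      show ?thesis by measurable
    qed
  qed (use fi in auto)
  also have "(\<lambda>n. LINT x|lebesgue. f x * m n x) = (\<lambda>n. LINT \<xi>|lebesgue. fourier_integral f \<xi> *
      (of_real (gauss_damping (1 / real (Suc n)) \<xi>) * cnj (fourier_integral g \<xi>)))"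
    unfolding m_def by (subst fourier_multiplication_formula[OF fi di]) simp
  finally show ?thesis
    by (simp add: L2_inner_def)
qed

lemma gauss_damping_tendsto_1: "(\<lambda>n. gauss_damping (1 / real (Suc n)) \<xi>) \<longlonglongrightarrow> 1"
proof -
  have "(\<lambda>n. exp (- (1 / real (Suc n) * norm \<xi>)\<^sup>2 / 2)) \<longlonglongrightarrow> exp (- (0 * norm \<xi>)\<^sup>2 / 2)"
    by (intro tendsto_intros LIMSEQ_Suc[OF lim_1_over_n]) simp
  then show ?thesis by (simp add: gauss_damping_def)
qed

lemma gauss_damping_mono:
  assumes "\<bar>\<epsilon>'\<bar> \<le> \<bar>\<epsilon>\<bar>" shows "gauss_damping \<epsilon> \<xi> \<le> gauss_damping \<epsilon>' \<xi>"
proof -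
  have "(\<epsilon>' * norm \<xi>)\<^sup>2 \<le> (\<epsilon> * norm \<xi>)\<^sup>2"
    using assms by (intro abs_le_square_iff[THEN iffD1]) (simp add: abs_mult mult_right_mono)
  then show ?thesis by (simp add: gauss_damping_def)
qed

text \<open>
  With \<open>g = f\<close> the damped integrands increase to the square of the modulus of the transform, so
  monotone convergence gives square integrability.
\<close>

lemma fourier_integral_bcont_L2:
  fixes f :: "'a::euclidean_space \<Rightarrow> complex"
  assumes f: "f \<in> bcont_L1"
  shows "fourier_integral f \<in> L2"
proof -
  have fi: "integrable lebesgue f" using f by (simp add: bcont_L1_def)
  have [measurable]: "fourier_integral f \<in> borel_measurable lebesgue"
    by (rule measurable_fourier_integral[OF fi])
  define h where "h n \<xi> = gauss_damping (1 / real (Suc n)) \<xi> * (norm (fourier_integral f \<xi>))\<^sup>2" for n \<xi>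
  have h_eq: "fourier_integral f \<xi> * (of_real (gauss_damping (1 / real (Suc n)) \<xi>) * cnj (fourier_integral f \<xi>))
      = of_real (h n \<xi>)" for n \<xi>
    by (simp add: h_def complex_norm_square ac_simps del: of_real_power)
  have "integrable lebesgue (\<lambda>\<xi>. complex_of_real (h n \<xi>))" for n
  proof -
    have "integrable lebesgue (\<lambda>\<xi>. of_real (gauss_damping (1 / real (Suc n)) \<xi>) * cnj (fourier_integral f \<xi>) * fourier_integral f \<xi>)"
      using norm_fourier_integral_le[OF fi]
      by (intro integrable_mult_bounded[OF integrable_fourier_mult_damping[OF fi]]) auto
    then show ?thesis by (simp add: h_eq[symmetric] ac_simps)
  qed
  then have hi: "integrable lebesgue (h n)" for n
    by (simp add: complex_of_real_integrable_eq)
  have "(\<lambda>n. complex_of_real (LINT \<xi>|lebesgue. h n \<xi>)) \<longlonglongrightarrow> L2_inner f f"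
    using damped_parseval_tendsto[OF f f] by (simp only: h_eq integral_complex_of_real)
  then have lim: "(\<lambda>n. LINT \<xi>|lebesgue. h n \<xi>) \<longlonglongrightarrow> Re (L2_inner f f)"
    using tendsto_Re by fastforce
  have "integrable lebesgue (\<lambda>\<xi>. (norm (fourier_integral f \<xi>))\<^sup>2)"
  proof (rule integral_monotone_convergence_nonneg[OF hi _ _ _ lim])
    show "AE \<xi> in lebesgue. mono (\<lambda>n. h n \<xi>)"
      unfolding h_def by (intro AE_I2 monoI mult_right_mono gauss_damping_mono) (auto simp: field_simps)
    show "AE \<xi> in lebesgue. 0 \<le> h n \<xi>" for n
      by (auto simp: h_def less_imp_le[OF gauss_damping_pos])
    have "(\<lambda>n. h n \<xi>) \<longlonglongrightarrow> 1 * (norm (fourier_integral f \<xi>))\<^sup>2" for \<xi>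
      unfolding h_def by (intro tendsto_mult tendsto_const gauss_damping_tendsto_1)
    then show "AE \<xi> in lebesgue. (\<lambda>n. h n \<xi>) \<longlonglongrightarrow> (norm (fourier_integral f \<xi>))\<^sup>2"
      by simp
  qed measurable
  then show ?thesis by (simp add: L2_def)
qed

text \<open>
  Now that the product of the transforms is known to be integrable, dominated convergence
  removes the damping.
\<close>

lemma parseval_bcont:
  fixes f g :: "'a::euclidean_space \<Rightarrow> complex"
  assumes f: "f \<in> bcont_L1" and g: "g \<in> bcont_L1"
  shows "L2_inner (fourier_integral f) (fourier_integral g) = L2_inner f g"
proof -
  note F = fourier_integral_bcont_L2[OF f] and G = fourier_integral_bcont_L2[OF g]
  have [measurable]: "fourier_integral f \<in> borel_measurable lebesgue" "fourier_integral g \<in> borel_measurable lebesgue"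
    using F G by auto
  have "(\<lambda>n. LINT \<xi>|lebesgue. fourier_integral f \<xi> *
      (of_real (gauss_damping (1 / real (Suc n)) \<xi>) * cnj (fourier_integral g \<xi>))) \<longlonglongrightarrow>
      (LINT \<xi>|lebesgue. fourier_integral f \<xi> * (of_real 1 * cnj (fourier_integral g \<xi>)))"
  proof (rule integral_dominated_convergence[where w = "\<lambda>\<xi>. norm (fourier_integral f \<xi> * cnj (fourier_integral g \<xi>))"])
    show "AE \<xi> in lebesgue. (\<lambda>n. fourier_integral f \<xi> *
      (of_real (gauss_damping (1 / real (Suc n)) \<xi>) * cnj (fourier_integral g \<xi>))) \<longlonglongrightarrow>
      fourier_integral f \<xi> * (of_real 1 * cnj (fourier_integral g \<xi>))"
      by (intro AE_I2 tendsto_mult tendsto_const tendsto_of_real gauss_damping_tendsto_1)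
    show "AE \<xi> in lebesgue. norm (fourier_integral f \<xi> *
      (of_real (gauss_damping (1 / real (Suc n)) \<xi>) * cnj (fourier_integral g \<xi>)))
      \<le> norm (fourier_integral f \<xi> * cnj (fourier_integral g \<xi>))" for n
    proof (rule AE_I2)
      fix \<xi> :: 'a
      have "\<bar>gauss_damping (1 / real (Suc n)) \<xi>\<bar> \<le> 1"
        using gauss_damping_le_1[of "1 / real (Suc n)" \<xi>] gauss_damping_pos[of "1 / real (Suc n)" \<xi>] by simp
      then show "norm (fourier_integral f \<xi> *
        (of_real (gauss_damping (1 / real (Suc n)) \<xi>) * cnj (fourier_integral g \<xi>)))
        \<le> norm (fourier_integral f \<xi> * cnj (fourier_integral g \<xi>))"
        by (simp add: norm_mult mult_left_mono mult_left_le_one_le del: of_nat_Suc)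
    qed
  qed (use L2_mult_integrable[OF F G] in auto)
  from LIMSEQ_unique[OF this damped_parseval_tendsto[OF f g]] show ?thesis
    by (simp add: L2_inner_def)
qed

section \<open>Parseval's identity for functions in \<open>L\<^sub>1 \<inter> L\<^sub>2\<close>\<close>

text \<open>
  The intersection of \<open>L\<^sub>1\<close> and \<open>L\<^sub>2\<close>, on which the Fourier integrals are defined before the
  extension to \<open>L\<^sub>2\<close>.
\<close>

definition L12 :: "('a::euclidean_space \<Rightarrow> complex) set" where
  "L12 = {f \<in> L2. integrable lebesgue f}"

lemma L12_L2: "f \<in> L12 \<Longrightarrow> f \<in> L2" and L12_integrable: "f \<in> L12 \<Longrightarrow> integrable lebesgue f"
  by (simp_all add: L12_def)

lemma L12_diff: "f \<in> L12 \<Longrightarrow> g \<in> L12 \<Longrightarrow> (\<lambda>x. f x - g x) \<in> L12"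
  by (simp add: L12_def L2_diff)

lemma L12_cnj: "f \<in> L12 \<Longrightarrow> (\<lambda>x. cnj (f x)) \<in> L12"
  by (simp add: L12_def L2_cnj_iff)

lemma bcont_L1_L12: "f \<in> bcont_L1 \<Longrightarrow> f \<in> L12"
  by (simp add: L12_def bcont_L1_L2) (simp add: bcont_L1_def)

lemma nn_integral_norm_dominated_tendsto_0:
  fixes u :: "nat \<Rightarrow> 'a::euclidean_space \<Rightarrow> complex" and w :: "'a \<Rightarrow> complex"
  assumes "\<And>k. u k \<in> borel_measurable lebesgue" "integrable lebesgue w"
    and bound: "\<And>k. AE x in lebesgue. norm (u k x) \<le> norm (w x)"
    and lim: "AE x in lebesgue. (\<lambda>k. u k x) \<longlonglongrightarrow> 0"
  shows "(\<lambda>k. \<integral>\<^sup>+x. ennreal (norm (u k x)) \<partial>lebesgue) \<longlonglongrightarrow> 0"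
proof -
  have [measurable]: "u k \<in> borel_measurable lebesgue" "w \<in> borel_measurable lebesgue" for k
    using assms by auto
  have "(\<lambda>k. \<integral>\<^sup>+x. ennreal (norm (u k x)) \<partial>lebesgue) \<longlonglongrightarrow> (\<integral>\<^sup>+x. 0 \<partial>(lebesgue :: 'a measure))"
  proof (rule nn_integral_dominated_convergence[where w = "\<lambda>x. ennreal (norm (w x))"])
    show "AE x in lebesgue. ennreal (norm (u j x)) \<le> ennreal (norm (w x))" for j
      by (rule eventually_mono[OF bound[of j]]) (rule ennreal_leI)
    show "(\<integral>\<^sup>+x. ennreal (norm (w x)) \<partial>lebesgue) < \<infinity>"
      using assms(2) by (simp add: integrable_iff_bounded)
    show "AE x in lebesgue. (\<lambda>k. ennreal (norm (u k x))) \<longlonglongrightarrow> 0"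
      using lim
    proof eventually_elim
      case (elim x)
      from tendsto_norm_zero[OF elim] show ?case
        by (subst ennreal_tendsto_0_iff) auto
    qed
  qed measurable
  then show ?thesis by simp
qed

lemma nn_sq_dominated_tendsto_0:
  fixes u :: "nat \<Rightarrow> 'a::euclidean_space \<Rightarrow> complex"
  assumes "\<And>k. u k \<in> borel_measurable lebesgue" "w \<in> L2"
    and bound: "\<And>k. AE x in lebesgue. norm (u k x) \<le> norm (w x)"
    and lim: "AE x in lebesgue. (\<lambda>k. u k x) \<longlonglongrightarrow> 0"
  shows "(\<lambda>k. nn_sq (u k)) \<longlonglongrightarrow> 0"
proof -
  have [measurable]: "u k \<in> borel_measurable lebesgue" "w \<in> borel_measurable lebesgue" for k
    using assms by auto
  have "(\<lambda>k. \<integral>\<^sup>+x. ennreal (norm (complex_of_real ((norm (u k x))\<^sup>2))) \<partial>lebesgue) \<longlonglongrightarrow> 0"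
  proof (rule nn_integral_norm_dominated_tendsto_0[where w = "\<lambda>x. complex_of_real ((norm (w x))\<^sup>2)"])
    show "integrable lebesgue (\<lambda>x. complex_of_real ((norm (w x))\<^sup>2))"
      using assms(2) unfolding L2_def by (intro integrable_of_real) simp
    show "AE x in lebesgue. norm (complex_of_real ((norm (u k x))\<^sup>2)) \<le> norm (complex_of_real ((norm (w x))\<^sup>2))" for k
      by (rule eventually_mono[OF bound[of k]]) (simp add: norm_power power_mono)
    show "AE x in lebesgue. (\<lambda>k. complex_of_real ((norm (u k x))\<^sup>2)) \<longlonglongrightarrow> 0"
      using lim
    proof eventually_elim
      case (elim x)
      have "(\<lambda>k. complex_of_real ((norm (u k x))\<^sup>2)) \<longlonglongrightarrow> of_real ((norm (0::complex))\<^sup>2)"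
        by (intro tendsto_intros elim)
      then show ?case by simp
    qed
  qed measurable
  then show ?thesis by (simp add: nn_sq_def norm_power)
qed

text \<open>
  A Lebesgue measurable function is the limit almost everywhere of continuous functions. If it
  is bounded with bounded support, these can be truncated continuously, so that the convergence
  is dominated and hence takes place in \<open>L\<^sub>1\<close> and in \<open>L\<^sub>2\<close> at the same time.
\<close>

lemma bcont_L1_approx_bounded:
  fixes f :: "'a::euclidean_space \<Rightarrow> complex"
  assumes f: "f \<in> borel_measurable lebesgue" and R: "0 < R"
    and bound: "\<And>x. norm (f x) \<le> R" and supp: "\<And>x. R < norm x \<Longrightarrow> f x = 0"
  obtains h where "\<And>n. h n \<in> bcont_L1"
    "(\<lambda>n. \<integral>\<^sup>+x. ennreal (norm (h n x - f x)) \<partial>lebesgue) \<longlonglongrightarrow> 0"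
    "(\<lambda>n. nn_sq (\<lambda>x. h n x - f x)) \<longlonglongrightarrow> 0"
proof -
  have "f measurable_on UNIV"
    using f by (intro lebesgue_measurable_imp_measurable_on) auto
  then obtain N g where N: "negligible N" and gc: "\<And>n. continuous_on UNIV (g n)"
    and glim: "\<And>x. x \<notin> N \<Longrightarrow> (\<lambda>n. g n x) \<longlonglongrightarrow> f x"
    by (auto simp: measurable_on_def)
  \<comment> \<open>\<open>clip\<close> retracts the plane onto the disc of radius \<open>R\<close>; \<open>cut\<close> is \<open>1\<close> on the ball of radius \<open>R\<close> and
    \<open>0\<close> off the ball of radius \<open>R + 1\<close>; \<open>w\<close> dominates \<open>h n\<close> and \<open>h n - f\<close>\<close>
  define clip :: "complex \<Rightarrow> complex" where "clip z = (R / max R (norm z)) *\<^sub>R z" for z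
  define cut :: "'a \<Rightarrow> real" where "cut x = max 0 (min 1 (R + 1 - norm x))" for x
  define h where "h n x = cut x *\<^sub>R clip (g n x)" for n x
  define w :: "'a \<Rightarrow> complex" where "w x = of_real (2 * R * indicat_real (cball 0 (R + 1)) x)" for x
  have clip_cont: "continuous_on UNIV clip"
    unfolding clip_def[abs_def] using R by (intro continuous_intros) (auto simp: max_def)
  have clip_bound: "norm (clip z) \<le> R" for z
    using R by (auto simp: clip_def max_def field_simps)
  have clip_id: "clip z = z" if "norm z \<le> R" for z
    using that R by (simp add: clip_def max_def)
  have cut_range: "0 \<le> cut x" "cut x \<le> 1" for x
    by (auto simp: cut_def)
  have cut_cont: "continuous_on UNIV cut"
    unfolding cut_def[abs_def] by (intro continuous_intros)
  have cut_eq_1: "cut x = 1" if "norm x \<le> R" for x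
    using that by (simp add: cut_def)
  have cut_eq_0: "cut x = 0" if "x \<notin> cball 0 (R + 1)" for x
    using that by (simp add: cut_def)
  have h_cont: "continuous_on UNIV (h n)" for n
    unfolding h_def[abs_def]
    by (intro continuous_intros cut_cont continuous_on_compose2[OF clip_cont gc]) auto
  have h_bound: "norm (h n x) \<le> R" for n x
    using mult_mono[OF cut_range(2) clip_bound[of "g n x"], of x] cut_range[of x] by (simp add: h_def)
  have fin: "emeasure lborel (cball (0::'a) (R + 1)) < \<infinity>"
    by (intro emeasure_bounded_finite bounded_cball)
  have w_int: "integrable lebesgue w"
    unfolding w_def using fin by (intro integrable_of_real integrable_mult_right integrable_real_indicator) simp_all
  have w_L2: "w \<in> L2"
  proof -
    have "(\<lambda>x. (norm (w x))\<^sup>2) = (\<lambda>x. (2 * R)\<^sup>2 * indicat_real (cball 0 (R + 1)) x)"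
      by (auto simp: w_def indicator_def fun_eq_iff)
    moreover have "integrable lebesgue (\<lambda>x. (2 * R)\<^sup>2 * indicat_real (cball (0::'a) (R + 1)) x)"
      using fin by (intro integrable_mult_right integrable_real_indicator) simp_all
    ultimately show ?thesis
      using w_int by (simp add: L2_def borel_measurable_integrable)
  qed
  have w_norm: "norm (w x) = (if x \<in> cball 0 (R + 1) then 2 * R else 0)" for x
    using R by (auto simp: w_def)
  have hm [measurable]: "h n \<in> borel_measurable lebesgue" for n
    by (intro borel_measurable_continuous_lebesgue h_cont)
  have h_w: "norm (h n x) \<le> norm (w x)" for n x
    using h_bound[of n x] R by (cases "x \<in> cball 0 (R + 1)") (auto simp: w_norm h_def cut_eq_0)
  have hf_w: "norm (h n x - f x) \<le> norm (w x)" for n x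
  proof (cases "x \<in> cball 0 (R + 1)")
    case True
    then show ?thesis
      using norm_triangle_ineq4[of "h n x" "f x"] h_bound[of n x] bound[of x] by (simp add: w_norm)
  next
    case False
    then show ?thesis using supp[of x] by (simp add: h_def cut_eq_0 w_norm)
  qed
  have lim: "AE x in lebesgue. (\<lambda>n. h n x - f x) \<longlonglongrightarrow> 0"
  proof (rule AE_I')
    show "N \<in> null_sets lebesgue" using N by (simp add: negligible_iff_null_sets)
    have "(\<lambda>n. h n x - f x) \<longlonglongrightarrow> 0" if "x \<notin> N" for x
    proof -
      have "(\<lambda>n. clip (g n x)) \<longlonglongrightarrow> clip (f x)"
        by (rule continuous_on_tendsto_compose[OF clip_cont glim[OF that]]) auto
      then have "(\<lambda>n. h n x) \<longlonglongrightarrow> cut x *\<^sub>R f x"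
        unfolding h_def clip_id[OF bound] by (intro tendsto_intros)
      moreover have "cut x *\<^sub>R f x = f x"
        using supp[of x] cut_eq_1[of x] by (cases "norm x \<le> R") auto
      ultimately show ?thesis by (simp add: LIM_zero_iff)
    qed
    then show "{x \<in> space lebesgue. \<not> (\<lambda>n. h n x - f x) \<longlonglongrightarrow> 0} \<subseteq> N" by auto
  qed
  have m: "(\<lambda>x. h n x - f x) \<in> borel_measurable lebesgue" for n
    using f by measurable
  show ?thesis
  proof
    show "h n \<in> bcont_L1" for n
    proof -
      have "integrable lebesgue (h n)"
        by (rule Bochner_Integration.integrable_bound[OF w_int hm]) (use h_w in auto)
      moreover have "bounded (range (h n))"
        using h_bound by (auto simp: bounded_iff)
      ultimately show ?thesis using h_cont by (simp add: bcont_L1_def)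
    qed
    show "(\<lambda>n. \<integral>\<^sup>+x. ennreal (norm (h n x - f x)) \<partial>lebesgue) \<longlonglongrightarrow> 0"
      by (rule nn_integral_norm_dominated_tendsto_0[OF m w_int _ lim]) (use hf_w in auto)
    show "(\<lambda>n. nn_sq (\<lambda>x. h n x - f x)) \<longlonglongrightarrow> 0"
      by (rule nn_sq_dominated_tendsto_0[OF m w_L2 _ lim]) (use hf_w in auto)
  qed
qed

lemma bcont_L1_dense:
  fixes f :: "'a::euclidean_space \<Rightarrow> complex"
  assumes f: "f \<in> L12" and e: "0 < e"
  obtains h where "h \<in> bcont_L1" "(\<integral>\<^sup>+x. ennreal (norm (h x - f x)) \<partial>lebesgue) < ennreal e"
    "nn_sq (\<lambda>x. h x - f x) < ennreal e"
proof -
  have [measurable]: "f \<in> borel_measurable lebesgue" using f by (auto simp: L12_def)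
  have fL: "f \<in> L2" "integrable lebesgue f" using f by (auto simp: L12_def)
  define t where "t k x = (if norm x \<le> real (Suc k) \<and> norm (f x) \<le> real (Suc k) then f x else 0)" for k x
  have norm_meas [measurable]: "(norm :: 'a \<Rightarrow> real) \<in> borel_measurable lebesgue"
    by (intro borel_measurable_continuous_lebesgue continuous_intros)
  have [measurable]: "t k \<in> borel_measurable lebesgue" for k
    unfolding t_def[abs_def] by measurable
  have tm: "(\<lambda>x. t k x - f x) \<in> borel_measurable lebesgue" for k by measurable
  have tb: "AE x in lebesgue. norm (t k x - f x) \<le> norm (f x)" for k
    by (auto simp: t_def)
  have tl: "AE x in lebesgue. (\<lambda>k. t k x - f x) \<longlonglongrightarrow> 0"
  proof (rule AE_I2)
    fix x
    obtain n where n: "norm x \<le> real n" "norm (f x) \<le> real n"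
      using real_arch_simple[of "max (norm x) (norm (f x))"] by auto
    have "t k x - f x = 0" if "n \<le> k" for k
      using that n by (simp add: t_def)
    then show "(\<lambda>k. t k x - f x) \<longlonglongrightarrow> 0"
      by (intro tendsto_eventually) (auto simp: eventually_sequentially)
  qed
  have e4: "0 < ennreal (e / 4)" using e by simp
  have "\<forall>\<^sub>F k in sequentially. (\<integral>\<^sup>+x. ennreal (norm (t k x - f x)) \<partial>lebesgue) < ennreal (e / 4)
      \<and> nn_sq (\<lambda>x. t k x - f x) < ennreal (e / 4)"
    by (intro eventually_conj order_tendstoD(2)[OF _ e4] nn_integral_norm_dominated_tendsto_0[OF tm fL(2) tb tl]
        nn_sq_dominated_tendsto_0[OF tm fL(1) tb tl])
  then obtain k where k: "(\<integral>\<^sup>+x. ennreal (norm (t k x - f x)) \<partial>lebesgue) < ennreal (e / 4)"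
      "nn_sq (\<lambda>x. t k x - f x) < ennreal (e / 4)"
    by (auto simp: eventually_sequentially)
  obtain h where hb: "\<And>n. h n \<in> bcont_L1"
    and h1: "(\<lambda>n. \<integral>\<^sup>+x. ennreal (norm (h n x - t k x)) \<partial>lebesgue) \<longlonglongrightarrow> 0"
    and h2: "(\<lambda>n. nn_sq (\<lambda>x. h n x - t k x)) \<longlonglongrightarrow> 0"
    by (rule bcont_L1_approx_bounded[of "t k" "real (Suc k)"]) (auto simp: t_def)
  have "\<forall>\<^sub>F n in sequentially. (\<integral>\<^sup>+x. ennreal (norm (h n x - t k x)) \<partial>lebesgue) < ennreal (e / 4)
      \<and> nn_sq (\<lambda>x. h n x - t k x) < ennreal (e / 4)"
    by (intro eventually_conj order_tendstoD(2)[OF _ e4] h1 h2)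
  then obtain n where n: "(\<integral>\<^sup>+x. ennreal (norm (h n x - t k x)) \<partial>lebesgue) < ennreal (e / 4)"
      "nn_sq (\<lambda>x. h n x - t k x) < ennreal (e / 4)"
    by (auto simp: eventually_sequentially)
  have [measurable]: "h n \<in> borel_measurable lebesgue"
    using L2_measurable[OF bcont_L1_L2[OF hb]] .
  show ?thesis
  proof
    show "h n \<in> bcont_L1" by (rule hb)
    have "(\<integral>\<^sup>+x. ennreal (norm (h n x - f x)) \<partial>lebesgue) \<le>
        (\<integral>\<^sup>+x. ennreal (norm (h n x - t k x)) + ennreal (norm (t k x - f x)) \<partial>lebesgue)"
    proof (rule nn_integral_mono)
      fix x
      have "norm (h n x - f x) \<le> norm (h n x - t k x) + norm (t k x - f x)"
        using norm_triangle_ineq[of "h n x - t k x" "t k x - f x"] by simp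
      then show "ennreal (norm (h n x - f x)) \<le> ennreal (norm (h n x - t k x)) + ennreal (norm (t k x - f x))"
        by (simp add: ennreal_plus[symmetric] ennreal_leI del: ennreal_plus)
    qed
    also have "\<dots> = (\<integral>\<^sup>+x. ennreal (norm (h n x - t k x)) \<partial>lebesgue) + (\<integral>\<^sup>+x. ennreal (norm (t k x - f x)) \<partial>lebesgue)"
      by (rule nn_integral_add) measurable
    also have "\<dots> \<le> 2 * ((\<integral>\<^sup>+x. ennreal (norm (h n x - t k x)) \<partial>lebesgue) + (\<integral>\<^sup>+x. ennreal (norm (t k x - f x)) \<partial>lebesgue))"
      by (simp add: mult_2)
    also have "\<dots> < ennreal e"
      by (rule two_mult_less_ennreal[OF n(1) k(1)])
    finally show "(\<integral>\<^sup>+x. ennreal (norm (h n x - f x)) \<partial>lebesgue) < ennreal e" .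
    have "nn_sq (\<lambda>x. h n x - f x) \<le> 2 * (nn_sq (\<lambda>x. h n x - t k x) + nn_sq (\<lambda>x. t k x - f x))"
      by (rule nn_sq_triangle) measurable
    also have "\<dots> < ennreal e"
      by (rule two_mult_less_ennreal[OF n(2) k(2)])
    finally show "nn_sq (\<lambda>x. h n x - f x) < ennreal e" .
  qed
qed

lemma L12_approx:
  fixes f :: "'a::euclidean_space \<Rightarrow> complex"
  assumes "f \<in> L12"
  obtains h where "\<And>n. h n \<in> bcont_L1"
    "(\<lambda>n. \<integral>\<^sup>+x. ennreal (norm (h n x - f x)) \<partial>lebesgue) \<longlonglongrightarrow> 0" "L2_tendsto h f"
proof -
  have "\<exists>h. h \<in> bcont_L1 \<and> (\<integral>\<^sup>+x. ennreal (norm (h x - f x)) \<partial>lebesgue) < ennreal (1 / real (Suc n))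
      \<and> nn_sq (\<lambda>x. h x - f x) < ennreal (1 / real (Suc n))" for n
    by (rule bcont_L1_dense[OF assms, of "1 / real (Suc n)"]) auto
  then obtain h where h: "\<And>n. h n \<in> bcont_L1"
    "\<And>n. (\<integral>\<^sup>+x. ennreal (norm (h n x - f x)) \<partial>lebesgue) < ennreal (1 / real (Suc n))"
    "\<And>n. nn_sq (\<lambda>x. h n x - f x) < ennreal (1 / real (Suc n))"
    by metis
  have lim: "(\<lambda>n. ennreal (1 / real (Suc n))) \<longlonglongrightarrow> 0"
    by (subst ennreal_tendsto_0_iff) (auto intro: LIMSEQ_Suc[OF lim_1_over_n] simp del: of_nat_Suc)
  show ?thesis
  proof
    show "h n \<in> bcont_L1" for n by (rule h)
    show "(\<lambda>n. \<integral>\<^sup>+x. ennreal (norm (h n x - f x)) \<partial>lebesgue) \<longlonglongrightarrow> 0"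
      by (rule tendsto_sandwich[OF _ _ tendsto_const lim]) (auto intro!: always_eventually less_imp_le h simp del: of_nat_Suc)
    show "L2_tendsto h f"
      unfolding L2_tendsto_iff
      by (rule tendsto_sandwich[OF _ _ tendsto_const lim]) (auto intro!: always_eventually less_imp_le h simp del: of_nat_Suc)
  qed
qed

text \<open>
  Convergence in \<open>L\<^sub>1\<close> gives pointwise convergence of the transforms. As the transform is isometric
  on the approximants, Fatou's lemma turns this into convergence in \<open>L\<^sub>2\<close>.
\<close>

lemma fourier_integral_approx:
  fixes f :: "'a::euclidean_space \<Rightarrow> complex"
  assumes f: "f \<in> L12" and h: "\<And>n. h n \<in> bcont_L1"
    and h1: "(\<lambda>n. \<integral>\<^sup>+x. ennreal (norm (h n x - f x)) \<partial>lebesgue) \<longlonglongrightarrow> 0"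
    and h2: "L2_tendsto h f"
  shows "L2_tendsto (\<lambda>n. fourier_integral (h n)) (fourier_integral f)"
proof -
  have hi: "integrable lebesgue (h n)" for n using h[of n] by (simp add: bcont_L1_def)
  have fi: "integrable lebesgue f" using f by (simp add: L12_def)
  have hL: "h n \<in> L2" for n by (rule bcont_L1_L2[OF h])
  have [measurable]: "h n \<in> borel_measurable lebesgue" "f \<in> borel_measurable lebesgue" for n
    using hi fi by auto
  have [measurable]: "fourier_integral (h n) \<in> borel_measurable lebesgue"
    "fourier_integral f \<in> borel_measurable lebesgue" for n
    by (auto intro: measurable_fourier_integral hi fi)
  have pointwise: "(\<lambda>n. fourier_integral (h n) \<xi>) \<longlonglongrightarrow> fourier_integral f \<xi>" for \<xi>
  proof -
    have "(\<lambda>n. ennreal (norm (fourier_integral (h n) \<xi> - fourier_integral f \<xi>))) \<longlonglongrightarrow> 0"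
    proof (rule tendsto_sandwich[OF _ _ tendsto_const h1])
      show "\<forall>\<^sub>F n in sequentially. ennreal (norm (fourier_integral (h n) \<xi> - fourier_integral f \<xi>))
          \<le> (\<integral>\<^sup>+x. ennreal (norm (h n x - f x)) \<partial>lebesgue)"
      proof (intro always_eventually allI)
        fix n
        have d: "integrable lebesgue (\<lambda>x. h n x - f x)" using hi fi by simp
        have "norm (fourier_integral (h n) \<xi> - fourier_integral f \<xi>) \<le> (LINT x|lebesgue. norm (h n x - f x))"
          using norm_fourier_integral_le[OF d] by (simp add: fourier_integral_diff[OF hi fi])
        then show "ennreal (norm (fourier_integral (h n) \<xi> - fourier_integral f \<xi>))
          \<le> (\<integral>\<^sup>+x. ennreal (norm (h n x - f x)) \<partial>lebesgue)"
          using d by (subst nn_integral_eq_integral) (auto intro: ennreal_leI)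
      qed
    qed auto
    then have "(\<lambda>n. norm (fourier_integral (h n) \<xi> - fourier_integral f \<xi>)) \<longlonglongrightarrow> 0"
      by (subst (asm) ennreal_tendsto_0_iff) auto
    from LIM_zero_cancel[OF tendsto_norm_zero_cancel[OF this]] show ?thesis .
  qed
  have iso: "nn_sq (\<lambda>\<xi>. fourier_integral (h m) \<xi> - fourier_integral (h n) \<xi>) = nn_sq (\<lambda>x. h m x - h n x)" for m n
  proof -
    have d: "(\<lambda>x. h m x - h n x) \<in> bcont_L1" by (intro bcont_L1_diff h)
    have "nn_sq (fourier_integral (\<lambda>x. h m x - h n x)) = nn_sq (\<lambda>x. h m x - h n x)"
      by (simp add: nn_sq_eq_inner fourier_integral_bcont_L2[OF d] bcont_L1_L2[OF d] parseval_bcont[OF d d])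
    moreover have "fourier_integral (\<lambda>x. h m x - h n x) = (\<lambda>\<xi>. fourier_integral (h m) \<xi> - fourier_integral (h n) \<xi>)"
      by (rule ext) (rule fourier_integral_diff[OF hi hi])
    ultimately show ?thesis by simp
  qed
  have bound: "nn_sq (\<lambda>\<xi>. fourier_integral f \<xi> - fourier_integral (h n) \<xi>) \<le> 2 * nn_sq (\<lambda>x. h n x - f x)" for n
  proof -
    have "nn_sq (\<lambda>\<xi>. fourier_integral f \<xi> - fourier_integral (h n) \<xi>)
        \<le> liminf (\<lambda>m. nn_sq (\<lambda>\<xi>. fourier_integral (h m) \<xi> - fourier_integral (h n) \<xi>))"
      by (intro nn_sq_liminf_le AE_I2 tendsto_intros pointwise) measurable
    also have "\<dots> = liminf (\<lambda>m. nn_sq (\<lambda>x. h m x - h n x))"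
      by (simp only: iso)
    also have "\<dots> \<le> liminf (\<lambda>m. 2 * (nn_sq (\<lambda>x. h m x - f x) + nn_sq (\<lambda>x. h n x - f x)))"
    proof (intro Liminf_mono always_eventually allI)
      fix m
      have "nn_sq (\<lambda>x. h m x - h n x) \<le> 2 * (nn_sq (\<lambda>x. h m x - f x) + nn_sq (\<lambda>x. f x - h n x))"
        by (rule nn_sq_triangle) measurable
      then show "nn_sq (\<lambda>x. h m x - h n x) \<le> 2 * (nn_sq (\<lambda>x. h m x - f x) + nn_sq (\<lambda>x. h n x - f x))"
        by (subst nn_sq_minus_commute[of "h n" f])
    qed
    also have "\<dots> = 2 * (0 + nn_sq (\<lambda>x. h n x - f x))"
      using h2[unfolded L2_tendsto_iff]
      by (intro lim_imp_Liminf ennreal_tendsto_cmult tendsto_add tendsto_const) auto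
    finally show ?thesis by simp
  qed
  have lim: "(\<lambda>n. 2 * nn_sq (\<lambda>x. h n x - f x)) \<longlonglongrightarrow> 2 * 0"
    using h2[unfolded L2_tendsto_iff] by (intro ennreal_tendsto_cmult) auto
  have lim': "(\<lambda>n. 2 * nn_sq (\<lambda>x. h n x - f x)) \<longlonglongrightarrow> 0" using lim by simp
  show ?thesis
    unfolding L2_tendsto_iff
    by (rule tendsto_sandwich[OF _ _ tendsto_const lim'])
       (auto intro!: always_eventually bound simp: nn_sq_minus_commute[of "fourier_integral (h n)" for n])
qed

lemma fourier_integral_L2:
  fixes f :: "'a::euclidean_space \<Rightarrow> complex"
  assumes f: "f \<in> L12" shows "fourier_integral f \<in> L2"
proof -
  obtain h where h: "\<And>n. h n \<in> bcont_L1"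
    "(\<lambda>n. \<integral>\<^sup>+x. ennreal (norm (h n x - f x)) \<partial>lebesgue) \<longlonglongrightarrow> 0" "L2_tendsto h f"
    using L12_approx[OF f] by blast
  show ?thesis
    using fourier_integral_approx[OF f h] fourier_integral_bcont_L2[OF h(1)]
      measurable_fourier_integral[OF L12_integrable[OF f]]
    by (rule L2_tendsto_L2_limit)
qed

text \<open>
  Identities between inner products pass to limits in \<open>L\<^sub>2\<close>, one argument at a time.
\<close>

lemma L2_inner_eq_by_approximation:
  assumes T: "L2_tendsto (\<lambda>n. F n) f'" "\<And>n. F n \<in> L2" "f' \<in> L2" "L2_tendsto f f0" "\<And>n. f n \<in> L2" "f0 \<in> L2"
    and w: "w' \<in> L2" "w \<in> L2" "\<And>n. L2_inner (F n) w' = L2_inner (f n) w"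
  shows "L2_inner f' w' = L2_inner f0 w"
  using L2_inner_tendsto[OF T(1,2,3) w(1)] L2_inner_tendsto[OF T(4,5,6) w(2)]
  unfolding w(3) by (rule LIMSEQ_unique)

lemma parseval_fourier_integral:
  fixes f g :: "'a::euclidean_space \<Rightarrow> complex"
  assumes f: "f \<in> L12" and g: "g \<in> L12"
  shows "L2_inner (fourier_integral f) (fourier_integral g) = L2_inner f g"
proof -
  have step: "L2_inner (fourier_integral f) (fourier_integral w) = L2_inner f w"
    if f: "f \<in> L12" and w: "w \<in> L12"
      and eq: "\<And>h. h \<in> bcont_L1 \<Longrightarrow> L2_inner (fourier_integral h) (fourier_integral w) = L2_inner h w"
    for f w :: "'a \<Rightarrow> complex"
  proof -
    obtain h where h: "\<And>n. h n \<in> bcont_L1"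
      "(\<lambda>n. \<integral>\<^sup>+x. ennreal (norm (h n x - f x)) \<partial>lebesgue) \<longlonglongrightarrow> 0" "L2_tendsto h f"
      using L12_approx[OF f] by blast
    show ?thesis
      by (rule L2_inner_eq_by_approximation[OF fourier_integral_approx[OF f h] fourier_integral_bcont_L2[OF h(1)]
            fourier_integral_L2[OF f] h(3) bcont_L1_L2[OF h(1)] L12_L2[OF f] fourier_integral_L2[OF w] L12_L2[OF w]
            eq[OF h(1)]])
  qed
  show ?thesis
  proof (rule step[OF f g])
    fix h :: "'a \<Rightarrow> complex" assume h: "h \<in> bcont_L1"
    have "L2_inner (fourier_integral g) (fourier_integral h) = L2_inner g h"
      by (rule step[OF g bcont_L1_L12[OF h]]) (rule parseval_bcont[OF _ h])
    then show "L2_inner (fourier_integral h) (fourier_integral g) = L2_inner h g"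
      by (subst (1 2) L2_inner_commute) simp
  qed
qed

section \<open>Extension of isometries to \<open>L\<^sub>2\<close>\<close>

text \<open>
  Completeness of \<open>L\<^sub>2\<close>, for sequences that converge fast. Here the series of \<open>2 ^ n * (norm (d n x))\<^sup>2\<close>,
  where \<open>d n\<close> are the successive differences, has a finite integral; it therefore converges almost
  everywhere, and this forces the series of \<open>d n x\<close> to converge absolutely.
\<close>

lemma L2_fast_cauchy_limit:
  fixes f :: "nat \<Rightarrow> 'a::euclidean_space \<Rightarrow> complex"
  assumes f: "\<And>n. f n \<in> L2"
    and cauchy: "\<And>m n. n \<le> m \<Longrightarrow> nn_sq (\<lambda>x. f m x - f n x) \<le> ennreal ((1 / 4) ^ n)"
  obtains v where "v \<in> L2" "L2_tendsto f v"
proof -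
  have [measurable]: "f n \<in> borel_measurable lebesgue" for n using f by auto
  define d where "d n x = f (Suc n) x - f n x" for n x
  define v where "v x = lim (\<lambda>n. f n x)" for x
  have vm [measurable]: "v \<in> borel_measurable lebesgue"
    unfolding v_def[abs_def] by measurable
  have dm [measurable]: "d n \<in> borel_measurable lebesgue" for n
    unfolding d_def[abs_def] by measurable
  have "(\<integral>\<^sup>+x. (\<Sum>n. ennreal (2 ^ n * (norm (d n x))\<^sup>2)) \<partial>lebesgue) =
      (\<Sum>n. \<integral>\<^sup>+x. ennreal (2 ^ n * (norm (d n x))\<^sup>2) \<partial>lebesgue)"
    by (rule nn_integral_suminf) measurable
  also have "\<dots> \<le> (\<Sum>n. ennreal ((1 / 2) ^ n))"
  proof (intro suminf_le allI summableI)
    fix n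
    have "(\<integral>\<^sup>+x. ennreal (2 ^ n * (norm (d n x))\<^sup>2) \<partial>lebesgue) = ennreal (2 ^ n) * nn_sq (d n)"
      unfolding nn_sq_def by (subst nn_integral_cmult[symmetric]) (auto simp: ennreal_mult)
    also have "\<dots> \<le> ennreal (2 ^ n) * ennreal ((1 / 4) ^ n)"
      unfolding d_def[abs_def] by (intro mult_left_mono cauchy) auto
    also have "\<dots> = ennreal ((1 / 2) ^ n)"
      by (simp add: ennreal_mult[symmetric] power_mult_distrib[symmetric])
    finally show "(\<integral>\<^sup>+x. ennreal (2 ^ n * (norm (d n x))\<^sup>2) \<partial>lebesgue) \<le> ennreal ((1 / 2) ^ n)" .
  qed
  also have "\<dots> = ennreal (\<Sum>n. (1 / 2) ^ n)"
    by (intro suminf_ennreal2 summable_geometric) auto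
  also have "\<dots> < \<infinity>"
    by (simp only: infinity_ennreal_def ennreal_less_top)
  finally have "AE x in lebesgue. (\<Sum>n. ennreal (2 ^ n * (norm (d n x))\<^sup>2)) \<noteq> \<infinity>"
    by (intro nn_integral_PInf_AE) (auto simp: less_top)
  then have lim: "AE x in lebesgue. (\<lambda>n. f n x) \<longlonglongrightarrow> v x"
  proof eventually_elim
    case (elim x)
    have "summable (\<lambda>n. 2 ^ n * (norm (d n x))\<^sup>2)"
      using elim by (intro summable_suminf_not_top) auto
    then have s: "summable (\<lambda>n. (1 / 2) ^ n + 2 ^ n * (norm (d n x))\<^sup>2)"
      by (intro summable_add summable_geometric) auto
    \<comment> \<open>either \<open>norm (d n x)\<close> is at most \<open>1 / 2 ^ n\<close>, or it is at most \<open>2 ^ n\<close> times its square\<close>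
    have "norm (d n x) \<le> (1 / 2) ^ n + 2 ^ n * (norm (d n x))\<^sup>2" for n
    proof (cases "2 ^ n * norm (d n x) \<le> 1")
      case True
      then have "norm (d n x) \<le> (1 / 2) ^ n"
        by (simp add: power_divide field_simps)
      then show ?thesis by (simp add: add_increasing2)
    next
      case False
      then have "1 * norm (d n x) \<le> (2 ^ n * norm (d n x)) * norm (d n x)"
        by (intro mult_right_mono) auto
      then show ?thesis by (simp add: power2_eq_square add_increasing mult.assoc)
    qed
    then have "summable (\<lambda>n. d n x)"
      by (intro summable_comparison_test[OF _ s]) auto
    then have "convergent (\<lambda>n. \<Sum>i<n. d i x)"
      by (simp add: summable_iff_convergent)
    moreover have "(\<Sum>i<n. d i x) = f n x - f 0 x" for n
      using sum_lessThan_telescope[of "\<lambda>i. f i x" n] by (simp add: d_def)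
    ultimately have "convergent (\<lambda>n. f n x - f 0 x)" by simp
    then have "convergent (\<lambda>n. f n x)"
      using convergent_add_const_iff[of "- f 0 x" "\<lambda>n. f n x"] by simp
    then show ?case unfolding v_def by (rule convergent_LIMSEQ_iff[THEN iffD1])
  qed
  have bound: "nn_sq (\<lambda>x. f n x - v x) \<le> ennreal ((1 / 4) ^ n)" for n
  proof -
    have "nn_sq (\<lambda>x. v x - f n x) \<le> liminf (\<lambda>m. nn_sq (\<lambda>x. f m x - f n x))"
    proof (rule nn_sq_liminf_le)
      show "AE x in lebesgue. (\<lambda>m. f m x - f n x) \<longlonglongrightarrow> v x - f n x"
        using lim by eventually_elim (intro tendsto_intros)
    qed measurable
    also have "\<dots> \<le> liminf (\<lambda>m. ennreal ((1 / 4) ^ n))"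
      by (intro Liminf_mono eventually_sequentiallyI[of n] cauchy)
    also have "\<dots> = ennreal ((1 / 4) ^ n)"
      by (intro lim_imp_Liminf) auto
    finally show ?thesis by (subst nn_sq_minus_commute)
  qed
  have pow: "(\<lambda>n. ennreal ((1 / 4) ^ n)) \<longlonglongrightarrow> 0"
    by (subst ennreal_tendsto_0_iff) (auto intro: LIMSEQ_power_zero)
  have t: "L2_tendsto f v"
    unfolding L2_tendsto_iff
    by (rule tendsto_sandwich[OF _ _ tendsto_const pow]) (auto intro!: always_eventually bound)
  show ?thesis
    by (rule that[OF L2_tendsto_L2_limit[OF t f vm] t])
qed

lemma L12_dense:
  fixes u :: "'a::euclidean_space \<Rightarrow> complex"
  assumes u: "u \<in> L2" and e: "0 < e"
  obtains f where "f \<in> L12" "nn_sq (\<lambda>x. f x - u x) < ennreal e"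
proof -
  have [measurable]: "u \<in> borel_measurable lebesgue" using u by auto
  define f where "f k x = (if norm x \<le> real k then u x else 0)" for k x
  have [measurable]: "(norm :: 'a \<Rightarrow> real) \<in> borel_measurable lebesgue"
    by (intro borel_measurable_continuous_lebesgue continuous_intros)
  have [measurable]: "f k \<in> borel_measurable lebesgue" for k
    unfolding f_def[abs_def] by measurable
  have fL: "f k \<in> L2" for k
    by (rule L2_dominated[OF u]) (auto simp: f_def)
  have "f k \<in> L12" for k
  proof -
    have "emeasure lborel (cball (0::'a) (real k)) < \<infinity>"
      by (intro emeasure_bounded_finite bounded_cball)
    then have int: "integrable lebesgue (\<lambda>x. indicat_real (cball (0::'a) (real k)) x + (norm (u x))\<^sup>2)"
      using u unfolding L2_def
      by (intro Bochner_Integration.integrable_add integrable_real_indicator) simp_all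
    have "norm (f k x) \<le> norm (indicat_real (cball (0::'a) (real k)) x + (norm (u x))\<^sup>2)" for x
    proof -
      have "norm (u x) \<le> 1 + (norm (u x))\<^sup>2"
        using sum_power2_ge_zero[of "norm (u x) - 1" 0] by (simp add: power2_eq_square algebra_simps) (smt (verit) norm_ge_zero)
      then show ?thesis by (auto simp: f_def)
    qed
    then have "integrable lebesgue (f k)"
      by (intro Bochner_Integration.integrable_bound[OF int]) auto
    with fL show ?thesis by (simp add: L12_def)
  qed
  moreover have "(\<lambda>k. nn_sq (\<lambda>x. f k x - u x)) \<longlonglongrightarrow> 0"
  proof (rule nn_sq_dominated_tendsto_0[OF _ u])
    show "AE x in lebesgue. (\<lambda>k. f k x - u x) \<longlonglongrightarrow> 0"
    proof (rule AE_I2)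
      fix x :: 'a
      obtain n where n: "norm x \<le> real n" using real_arch_simple by blast
      have "f k x - u x = 0" if "n \<le> k" for k using that n by (simp add: f_def)
      then show "(\<lambda>k. f k x - u x) \<longlonglongrightarrow> 0"
        by (intro tendsto_eventually) (auto simp: eventually_sequentially)
    qed
  qed (auto simp: f_def)
  from order_tendstoD(2)[OF this, of "ennreal e"] e
  obtain k where "nn_sq (\<lambda>x. f k x - u x) < ennreal e"
    by (auto simp: eventually_sequentially)
  ultimately show ?thesis using that by blast
qed

lemma L12_fast_approx:
  fixes u :: "'a::euclidean_space \<Rightarrow> complex"
  assumes u: "u \<in> L2"
  obtains f where "\<And>n. f n \<in> L12" "L2_tendsto f u"
    "\<And>m n. n \<le> m \<Longrightarrow> nn_sq (\<lambda>x. f m x - f n x) \<le> ennreal ((1 / 4) ^ n)"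
proof -
  \<comment> \<open>the factor \<open>1 / 4\<close> absorbs the constants of the quasi-triangle inequality\<close>
  have "\<exists>f. f \<in> L12 \<and> nn_sq (\<lambda>x. f x - u x) < ennreal ((1 / 4) ^ n / 4)" for n :: nat
    by (rule L12_dense[OF u, of "(1 / 4) ^ n / 4"]) auto
  then obtain f where f: "\<And>n. f n \<in> L12" and fu: "\<And>n. nn_sq (\<lambda>x. f n x - u x) < ennreal ((1 / 4) ^ n / 4)"
    by metis
  have [measurable]: "u \<in> borel_measurable lebesgue" "f n \<in> borel_measurable lebesgue" for n
    using u L12_L2[OF f] by auto
  show ?thesis
  proof
    show "f n \<in> L12" for n by (rule f)
    have lim: "(\<lambda>n. ennreal ((1 / 4) ^ n / 4)) \<longlonglongrightarrow> 0"
      by (subst ennreal_tendsto_0_iff) (auto intro!: tendsto_divide_zero LIMSEQ_power_zero)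
    show "L2_tendsto f u"
      unfolding L2_tendsto_iff
      by (rule tendsto_sandwich[OF _ _ tendsto_const lim]) (auto intro!: always_eventually less_imp_le fu)
    fix m n :: nat assume "n \<le> m"
    then have "(1 / 4 :: real) ^ m \<le> (1 / 4) ^ n"
      by (intro power_decreasing) auto
    then have m: "nn_sq (\<lambda>x. f m x - u x) < ennreal ((1 / 4) ^ n / 4)"
      by (intro less_le_trans[OF fu[of m]] ennreal_leI) simp
    have "nn_sq (\<lambda>x. f m x - f n x) \<le> 2 * (nn_sq (\<lambda>x. f m x - u x) + nn_sq (\<lambda>x. u x - f n x))"
      by (rule nn_sq_triangle) measurable
    also have "nn_sq (\<lambda>x. u x - f n x) = nn_sq (\<lambda>x. f n x - u x)"
      by (rule nn_sq_minus_commute)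
    also have "2 * (nn_sq (\<lambda>x. f m x - u x) + nn_sq (\<lambda>x. f n x - u x)) < ennreal ((1 / 4) ^ n)"
      by (rule two_mult_less_ennreal[OF m fu])
    finally show "nn_sq (\<lambda>x. f m x - f n x) \<le> ennreal ((1 / 4) ^ n)" by simp
  qed
qed

lemma L12_approx_L2:
  assumes u: "u \<in> L2"
  obtains f where "\<And>n. f n \<in> L12" "L2_tendsto f u"
  using L12_fast_approx[OF u] by metis

text \<open>
  The properties shared by the Fourier integral and the inverse Fourier integral that make the
  extension to \<open>L\<^sub>2\<close> work.
\<close>

locale parseval_operator =
  fixes T :: "('a::euclidean_space \<Rightarrow> complex) \<Rightarrow> 'a \<Rightarrow> complex"
  assumes T_L2: "f \<in> L12 \<Longrightarrow> T f \<in> L2"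
    and T_diff: "f \<in> L12 \<Longrightarrow> g \<in> L12 \<Longrightarrow> T (\<lambda>x. f x - g x) \<xi> = T f \<xi> - T g \<xi>"
    and T_parseval: "f \<in> L12 \<Longrightarrow> g \<in> L12 \<Longrightarrow> L2_inner (T f) (T g) = L2_inner f g"
begin

lemma nn_sq_T_diff:
  assumes f: "f \<in> L12" and g: "g \<in> L12"
  shows "nn_sq (\<lambda>\<xi>. T f \<xi> - T g \<xi>) = nn_sq (\<lambda>x. f x - g x)"
proof -
  have d: "(\<lambda>x. f x - g x) \<in> L12" by (intro L12_diff f g)
  have "T (\<lambda>x. f x - g x) = (\<lambda>\<xi>. T f \<xi> - T g \<xi>)"
    by (rule ext) (rule T_diff[OF f g])
  then have "nn_sq (\<lambda>\<xi>. T f \<xi> - T g \<xi>) = nn_sq (T (\<lambda>x. f x - g x))" by simp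
  also have "\<dots> = nn_sq (\<lambda>x. f x - g x)"
    by (simp only: nn_sq_eq_inner[OF T_L2[OF d]] nn_sq_eq_inner[OF L12_L2[OF d]] T_parseval[OF d d])
  finally show ?thesis .
qed

text \<open>
  One approximating sequence that converges fast has a limit \<open>v\<close> of its images, and any other
  approximating sequence has the same limit because \<open>T\<close> is isometric.
\<close>

lemma extension_exists:
  assumes u: "u \<in> L2"
  shows "\<exists>v. v \<in> L2 \<and> (\<forall>f. (\<forall>n. f n \<in> L2 \<and> integrable lebesgue (f n)) \<and> L2_tendsto f u
      \<longrightarrow> L2_tendsto (\<lambda>n. T (f n)) v)"
proof -
  obtain f where f: "\<And>n. f n \<in> L12" and fu: "L2_tendsto f u"
    and fast: "\<And>m n. n \<le> m \<Longrightarrow> nn_sq (\<lambda>x. f m x - f n x) \<le> ennreal ((1 / 4) ^ n)"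
    using L12_fast_approx[OF u] by metis
  obtain v where v: "v \<in> L2" and fv: "L2_tendsto (\<lambda>n. T (f n)) v"
    by (rule L2_fast_cauchy_limit[of "\<lambda>n. T (f n)"]) (auto simp: nn_sq_T_diff f fast T_L2)
  have "L2_tendsto (\<lambda>n. T (g n)) v" if g: "\<And>n. g n \<in> L12" and gu: "L2_tendsto g u" for g
  proof -
    have [measurable]: "u \<in> borel_measurable lebesgue" "v \<in> borel_measurable lebesgue"
      "f n \<in> borel_measurable lebesgue" "g n \<in> borel_measurable lebesgue"
      "T (f n) \<in> borel_measurable lebesgue" "T (g n) \<in> borel_measurable lebesgue" for n
      using u v L12_L2[OF f] L12_L2[OF g] T_L2[OF f] T_L2[OF g] by auto
    have bound: "nn_sq (\<lambda>x. T (g n) x - v x) \<le>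
        2 * (2 * (nn_sq (\<lambda>x. g n x - u x) + nn_sq (\<lambda>x. f n x - u x)) + nn_sq (\<lambda>x. T (f n) x - v x))" for n
    proof -
      have "nn_sq (\<lambda>x. T (g n) x - v x) \<le>
          2 * (nn_sq (\<lambda>x. T (g n) x - T (f n) x) + nn_sq (\<lambda>x. T (f n) x - v x))"
        by (rule nn_sq_triangle) measurable
      also have "nn_sq (\<lambda>x. T (g n) x - T (f n) x) = nn_sq (\<lambda>x. g n x - f n x)"
        by (rule nn_sq_T_diff[OF g f])
      also have "2 * (nn_sq (\<lambda>x. g n x - f n x) + nn_sq (\<lambda>x. T (f n) x - v x)) \<le>
          2 * (2 * (nn_sq (\<lambda>x. g n x - u x) + nn_sq (\<lambda>x. u x - f n x)) + nn_sq (\<lambda>x. T (f n) x - v x))"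
        by (intro mult_left_mono add_right_mono nn_sq_triangle) auto
      also have "nn_sq (\<lambda>x. u x - f n x) = nn_sq (\<lambda>x. f n x - u x)"
        by (rule nn_sq_minus_commute)
      finally show ?thesis .
    qed
    have lim: "(\<lambda>n. 2 * (2 * (nn_sq (\<lambda>x. g n x - u x) + nn_sq (\<lambda>x. f n x - u x)) + nn_sq (\<lambda>x. T (f n) x - v x)))
        \<longlonglongrightarrow> 2 * (2 * (0 + 0) + 0)"
      using gu fu fv unfolding L2_tendsto_iff
      by (intro ennreal_tendsto_cmult tendsto_add) auto
    then have lim': "(\<lambda>n. 2 * (2 * (nn_sq (\<lambda>x. g n x - u x) + nn_sq (\<lambda>x. f n x - u x)) + nn_sq (\<lambda>x. T (f n) x - v x)))
        \<longlonglongrightarrow> 0"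
      by simp
    show ?thesis
      unfolding L2_tendsto_iff
      by (rule tendsto_sandwich[OF always_eventually always_eventually tendsto_const lim'])
        (intro allI zero_le, intro allI bound)
  qed
  then show ?thesis
    using v by (auto simp: L12_def)
qed

lemma extension_L2: "u \<in> L2 \<Longrightarrow> L2_extension T u \<in> L2"
  and extension_tendsto: "u \<in> L2 \<Longrightarrow> (\<And>n. f n \<in> L12) \<Longrightarrow> L2_tendsto f u \<Longrightarrow>
      L2_tendsto (\<lambda>n. T (f n)) (L2_extension T u)"
  using someI_ex[OF extension_exists[of u]] unfolding L2_extension_def L12_def by auto

lemma extension_parseval:
  assumes u: "u \<in> L2" and v: "v \<in> L2"
  shows "L2_inner (L2_extension T u) (L2_extension T v) = L2_inner u v"
proof -
  have step: "L2_inner (L2_extension T u) w' = L2_inner u w"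
    if u: "u \<in> L2" and w: "w' \<in> L2" "w \<in> L2" and eq: "\<And>h. h \<in> L12 \<Longrightarrow> L2_inner (T h) w' = L2_inner h w"
    for u w w'
  proof -
    obtain f where f: "\<And>n. f n \<in> L12" "L2_tendsto f u"
      using L12_approx_L2[OF u] by metis
    show ?thesis
      by (rule L2_inner_eq_by_approximation[OF extension_tendsto[OF u f] T_L2[OF f(1)] extension_L2[OF u]
            f(2) L12_L2[OF f(1)] u w eq[OF f(1)]])
  qed
  show ?thesis
  proof (rule step[OF u extension_L2[OF v] v])
    fix h :: "'a \<Rightarrow> complex" assume h: "h \<in> L12"
    have "L2_inner (L2_extension T v) (T h) = L2_inner v h"
      by (rule step[OF v T_L2[OF h] L12_L2[OF h]]) (rule T_parseval[OF _ h])
    then show "L2_inner (T h) (L2_extension T v) = L2_inner h v"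
      by (subst (1 2) L2_inner_commute) simp
  qed
qed

end

text \<open>
  Operators that are adjoint to each other on \<open>L12\<close> have adjoint extensions.
\<close>

lemma extension_adjoint:
  assumes "parseval_operator T" "parseval_operator S"
    and adj: "\<And>f g. f \<in> L12 \<Longrightarrow> g \<in> L12 \<Longrightarrow> L2_inner (T f) g = L2_inner f (S g)"
    and u: "u \<in> L2" and v: "v \<in> L2"
  shows "L2_inner (L2_extension T u) v = L2_inner u (L2_extension S v)"
proof -
  interpret T: parseval_operator T by fact
  interpret S: parseval_operator S by fact
  obtain f where f: "\<And>n. f n \<in> L12" "L2_tendsto f u"
    using L12_approx_L2[OF u] by metis
  obtain g where g: "\<And>n. g n \<in> L12" "L2_tendsto g v"
    using L12_approx_L2[OF v] by metis
  have "L2_inner (L2_extension T u) (g m) = L2_inner u (S (g m))" for m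
    by (rule L2_inner_eq_by_approximation[OF T.extension_tendsto[OF u f] T.T_L2[OF f(1)] T.extension_L2[OF u]
          f(2) L12_L2[OF f(1)] u L12_L2[OF g(1)] S.T_L2[OF g(1)] adj[OF f(1) g(1)]])
  then have eq: "L2_inner (g m) (L2_extension T u) = L2_inner (S (g m)) u" for m
    by (subst (1 2) L2_inner_commute) simp
  have "L2_inner v (L2_extension T u) = L2_inner (L2_extension S v) u"
    by (rule L2_inner_eq_by_approximation[OF g(2) L12_L2[OF g(1)] v S.extension_tendsto[OF v g] S.T_L2[OF g(1)]
          S.extension_L2[OF v] T.extension_L2[OF u] u eq])
  then show ?thesis
    by (subst (1 2) L2_inner_commute) simp
qed

text \<open>
  The adjoint of an isometry is a left inverse of it. Inversion on \<open>L\<^sub>2\<close> thus follows from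
  Parseval's identity, without any pointwise inversion formula.
\<close>

lemma extension_inverse:
  assumes T: "parseval_operator T" and S: "parseval_operator S"
    and adj: "\<And>f g. f \<in> L12 \<Longrightarrow> g \<in> L12 \<Longrightarrow> L2_inner (T f) g = L2_inner f (S g)"
    and u: "u \<in> L2"
  shows "AE x in lebesgue. L2_extension S (L2_extension T u) x = u x"
proof -
  interpret T: parseval_operator T by fact
  interpret S: parseval_operator S by fact
  note Tu = T.extension_L2[OF u]
  show ?thesis
  proof (rule L2_eqI_AE[OF S.extension_L2[OF Tu] u])
    fix w :: "'a \<Rightarrow> complex" assume w: "w \<in> L2"
    have "L2_inner w (L2_extension S (L2_extension T u)) = L2_inner w u"
      using extension_adjoint[OF T S adj w Tu] T.extension_parseval[OF w u] by simp
    then show "L2_inner (L2_extension S (L2_extension T u)) w = L2_inner u w"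
      by (subst (1 2) L2_inner_commute) simp
  qed
qed

lemma extension_cong_AE:
  assumes T: "parseval_operator T" and u: "u \<in> L2" and v: "v \<in> L2" and uv: "AE x in lebesgue. u x = v x"
  shows "AE x in lebesgue. L2_extension T u x = L2_extension T v x"
proof -
  interpret T: parseval_operator T by fact
  obtain f where f: "\<And>n. f n \<in> L12" "L2_tendsto f u"
    using L12_approx_L2[OF u] by metis
  have "nn_sq (\<lambda>x. f n x - u x) = nn_sq (\<lambda>x. f n x - v x)" for n
    unfolding nn_sq_def by (rule nn_integral_cong_AE) (use uv in eventually_elim, simp)
  then have fv: "L2_tendsto f v" using f(2) by (simp add: L2_tendsto_iff)
  show ?thesis
  proof (rule L2_eqI_AE[OF T.extension_L2[OF u] T.extension_L2[OF v]])
    fix w :: "'a \<Rightarrow> complex" assume w: "w \<in> L2"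
    show "L2_inner (L2_extension T u) w = L2_inner (L2_extension T v) w"
      by (rule LIMSEQ_unique[OF
            L2_inner_tendsto[OF T.extension_tendsto[OF u f] T.T_L2[OF f(1)] T.extension_L2[OF u] w]
            L2_inner_tendsto[OF T.extension_tendsto[OF v f(1) fv] T.T_L2[OF f(1)] T.extension_L2[OF v] w]])
  qed
qed

section \<open>Plancherel's theorem and Fourier inversion\<close>

lemma parseval_operator_fourier: "parseval_operator fourier_integral"
proof
  fix f g :: "'a \<Rightarrow> complex" and \<xi>
  assume f: "f \<in> L12"
  show "fourier_integral f \<in> L2" by (rule fourier_integral_L2[OF f])
  assume g: "g \<in> L12"
  show "fourier_integral (\<lambda>x. f x - g x) \<xi> = fourier_integral f \<xi> - fourier_integral g \<xi>"
    by (rule fourier_integral_diff[OF L12_integrable[OF f] L12_integrable[OF g]])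
  show "L2_inner (fourier_integral f) (fourier_integral g) = L2_inner f g"
    by (rule parseval_fourier_integral[OF f g])
qed

lemma L2_inner_cnj: "L2_inner (\<lambda>x. cnj (u x)) (\<lambda>x. cnj (v x)) = cnj (L2_inner u v)"
  unfolding L2_inner_def by (subst Bochner_Integration.integral_cnj[symmetric]) simp

lemma parseval_operator_inv_fourier: "parseval_operator inv_fourier_integral"
proof
  fix f g :: "'a \<Rightarrow> complex" and \<xi>
  assume f: "f \<in> L12"
  note f' = L12_cnj[OF f]
  show "inv_fourier_integral f \<in> L2"
    unfolding inv_fourier_integral_eq[abs_def] by (simp add: L2_cnj_iff fourier_integral_L2[OF f'])
  assume g: "g \<in> L12"
  note g' = L12_cnj[OF g]
  show "inv_fourier_integral (\<lambda>x. f x - g x) \<xi> = inv_fourier_integral f \<xi> - inv_fourier_integral g \<xi>"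
    unfolding inv_fourier_integral_eq
    by (simp add: fourier_integral_diff[OF L12_integrable[OF f'] L12_integrable[OF g']])
  show "L2_inner (inv_fourier_integral f) (inv_fourier_integral g) = L2_inner f g"
    unfolding inv_fourier_integral_eq[abs_def]
    by (simp only: L2_inner_cnj parseval_fourier_integral[OF f' g'] complex_cnj_cnj)
qed

lemma fourier_integral_adjoint:
  assumes "f \<in> L12" "g \<in> L12"
  shows "L2_inner (fourier_integral f) g = L2_inner f (inv_fourier_integral g)"
  unfolding L2_inner_def inv_fourier_integral_eq complex_cnj_cnj
  by (rule fourier_multiplication_formula[OF L12_integrable[OF assms(1)] L12_integrable[OF L12_cnj[OF assms(2)]]])

lemma inv_fourier_integral_adjoint:
  assumes "f \<in> L12" "g \<in> L12"
  shows "L2_inner (inv_fourier_integral f) g = L2_inner f (fourier_integral g)"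
  using fourier_integral_adjoint[OF assms(2,1)] by (subst (1 2) L2_inner_commute) simp

lemma fourier_L2: "u \<in> L2 \<Longrightarrow> fourier u \<in> L2"
  unfolding fourier_def by (rule parseval_operator.extension_L2[OF parseval_operator_fourier])

lemma inv_fourier_L2: "u \<in> L2 \<Longrightarrow> inv_fourier u \<in> L2"
  unfolding inv_fourier_def by (rule parseval_operator.extension_L2[OF parseval_operator_inv_fourier])

lemma plancherel: "u \<in> L2 \<Longrightarrow> v \<in> L2 \<Longrightarrow> L2_inner (fourier u) (fourier v) = L2_inner u v"
  unfolding fourier_def by (rule parseval_operator.extension_parseval[OF parseval_operator_fourier])

lemma inv_fourier_fourier: "u \<in> L2 \<Longrightarrow> AE x in lebesgue. inv_fourier (fourier u) x = u x"
  unfolding fourier_def inv_fourier_def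
  by (rule extension_inverse[OF parseval_operator_fourier parseval_operator_inv_fourier fourier_integral_adjoint])

lemma fourier_inv_fourier: "u \<in> L2 \<Longrightarrow> AE x in lebesgue. fourier (inv_fourier u) x = u x"
  unfolding fourier_def inv_fourier_def
  by (rule extension_inverse[OF parseval_operator_inv_fourier parseval_operator_fourier inv_fourier_integral_adjoint])

lemma inv_fourier_cong_AE:
  "u \<in> L2 \<Longrightarrow> v \<in> L2 \<Longrightarrow> AE x in lebesgue. u x = v x \<Longrightarrow> AE x in lebesgue. inv_fourier u x = inv_fourier v x"
  unfolding inv_fourier_def by (rule extension_cong_AE[OF parseval_operator_inv_fourier])

section \<open>Sobolev spaces and the adjoint of the embedding\<close>

lemma bessel_symbol_pos: "0 < bessel_symbol t \<xi>"
proof -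
  have "0 < 1 + 4 * pi\<^sup>2 * (norm \<xi>)\<^sup>2" by (intro add_pos_nonneg) auto
  then show ?thesis by (simp add: bessel_symbol_def)
qed

lemma bessel_symbol_add: "bessel_symbol a \<xi> * bessel_symbol b \<xi> = bessel_symbol (a + b) \<xi>"
  by (simp add: bessel_symbol_def powr_add)

lemma bessel_symbol_0: "bessel_symbol 0 \<xi> = 1"
proof -
  have "0 < 1 + 4 * pi\<^sup>2 * (norm \<xi>)\<^sup>2" by (intro add_pos_nonneg) auto
  then show ?thesis by (simp add: bessel_symbol_def)
qed

lemma bessel_symbol_le_1: "t \<le> 0 \<Longrightarrow> bessel_symbol t \<xi> \<le> 1"
  unfolding bessel_symbol_def using powr_mono[of t 0 "1 + 4 * pi\<^sup>2 * (norm \<xi>)\<^sup>2"] by (simp split: if_splits)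

lemma measurable_bessel_symbol [measurable]: "bessel_symbol t \<in> borel_measurable lebesgue"
proof (intro borel_measurable_continuous_lebesgue)
  have "1 + 4 * pi\<^sup>2 * (norm \<xi>)\<^sup>2 \<noteq> 0" for \<xi> :: 'a
    by (smt (verit) mult_nonneg_nonneg zero_le_power2)
  then show "continuous_on UNIV (bessel_symbol t :: 'a \<Rightarrow> real)"
    unfolding bessel_symbol_def[abs_def] by (intro continuous_intros) auto
qed

lemma bessel_symbol_mult_L2:
  fixes u :: "'a::euclidean_space \<Rightarrow> complex"
  assumes "t \<le> 0" "u \<in> L2"
  shows "(\<lambda>\<xi>. of_real (bessel_symbol t \<xi>) * u \<xi>) \<in> L2"
proof (rule L2_bounded_mult[OF assms(2) measurable_bessel_symbol])
  show "\<bar>bessel_symbol t \<xi>\<bar> \<le> 1" for \<xi> :: 'a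
    using bessel_symbol_le_1[OF assms(1), of \<xi>] bessel_symbol_pos[of t \<xi>] by simp
qed

lemma L2_cong_AE:
  assumes "u \<in> L2" "v \<in> borel_measurable lebesgue" "AE x in lebesgue. u x = v x" shows "v \<in> L2"
  by (rule L2_dominated[OF assms(1,2)]) (use assms(3) in eventually_elim, simp)

lemma inv_fourier_in_sobolev:
  assumes h: "h \<in> L2" and sh: "(\<lambda>\<xi>. of_real (bessel_symbol (s / 2) \<xi>) * h \<xi>) \<in> L2"
  shows "inv_fourier h \<in> sobolev_space s"
proof -
  have [measurable]: "h \<in> borel_measurable lebesgue" "fourier (inv_fourier h) \<in> borel_measurable lebesgue"
    using h fourier_L2[OF inv_fourier_L2[OF h]] by auto
  have "(\<lambda>\<xi>. of_real (bessel_symbol (s / 2) \<xi>) * fourier (inv_fourier h) \<xi>) \<in> L2"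
    by (rule L2_cong_AE[OF sh], measurable)
      (use fourier_inv_fourier[OF h] in eventually_elim, simp)
  then show ?thesis
    unfolding sobolev_space_def by (simp add: inv_fourier_L2[OF h] inv_fourier_L2)
qed

lemma sobolev_inner_eq_L2_inner:
  fixes u v :: "'a::euclidean_space \<Rightarrow> complex"
  shows "sobolev_inner s u v = L2_inner (\<lambda>\<xi>. of_real (bessel_symbol (s / 2) \<xi>) * fourier u \<xi>)
     (\<lambda>\<xi>. of_real (bessel_symbol (s / 2) \<xi>) * fourier v \<xi>)"
  unfolding sobolev_inner_def L2_inner_def
proof (intro Bochner_Integration.integral_cong refl)
  fix \<xi> :: 'a
  have "of_real (bessel_symbol s \<xi>) = complex_of_real (bessel_symbol (s / 2) \<xi>) * of_real (bessel_symbol (s / 2) \<xi>)"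
    using bessel_symbol_add[of "s / 2" \<xi> "s / 2"] by (simp flip: of_real_mult)
  then show "of_real (bessel_symbol s \<xi>) * fourier u \<xi> * cnj (fourier v \<xi>) =
      of_real (bessel_symbol (s / 2) \<xi>) * fourier u \<xi> * cnj (of_real (bessel_symbol (s / 2) \<xi>) * fourier v \<xi>)"
    by (simp add: ac_simps)
qed

lemma bessel_potential_in_sobolev:
  fixes u :: "'a::euclidean_space \<Rightarrow> complex"
  assumes "0 \<le> s" "u \<in> L2"
  shows "bessel_potential (2 * s) u \<in> sobolev_space s"
proof -
  have "(\<lambda>\<xi>. complex_of_real (bessel_symbol (s / 2) \<xi>) * (of_real (bessel_symbol (- s) \<xi>) * fourier u \<xi>)) =
      (\<lambda>\<xi>. of_real (bessel_symbol (- s / 2) \<xi>) * fourier u \<xi>)"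
    using bessel_symbol_add[of "s / 2" _ "- s", where 'a = 'a] by (simp add: mult.assoc[symmetric] flip: of_real_mult)
  moreover have "\<dots> \<in> L2"
    using assms by (intro bessel_symbol_mult_L2 fourier_L2) auto
  ultimately show ?thesis
    unfolding bessel_potential_def
    using assms by (simp add: inv_fourier_in_sobolev bessel_symbol_mult_L2 fourier_L2)
qed

lemma sobolev_inner_bessel_potential:
  fixes u v :: "'a::euclidean_space \<Rightarrow> complex"
  assumes s: "0 \<le> s" and u: "u \<in> L2" and v: "v \<in> L2"
  shows "sobolev_inner s (bessel_potential (2 * s) u) v = L2_inner u v"
proof -
  define B where "B \<xi> = of_real (bessel_symbol (- s) \<xi>) * fourier u \<xi>" for \<xi>
  have B: "B \<in> L2"
    unfolding B_def[abs_def] using s u by (intro bessel_symbol_mult_L2 fourier_L2) auto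
  note [measurable] = L2_measurable[OF B] L2_measurable[OF fourier_L2[OF inv_fourier_L2[OF B]]]
    L2_measurable[OF fourier_L2[OF u]] L2_measurable[OF fourier_L2[OF v]]
  have "bessel_potential (2 * s) u = inv_fourier B"
    by (simp add: bessel_potential_def B_def[abs_def])
  then have "sobolev_inner s (bessel_potential (2 * s) u) v =
      (LINT \<xi>|lebesgue. of_real (bessel_symbol s \<xi>) * fourier (inv_fourier B) \<xi> * cnj (fourier v \<xi>))"
    by (simp add: sobolev_inner_def)
  also have "\<dots> = (LINT \<xi>|lebesgue. fourier u \<xi> * cnj (fourier v \<xi>))"
  proof (rule integral_cong_AE, measurable)
    show "AE \<xi> in lebesgue. of_real (bessel_symbol s \<xi>) * fourier (inv_fourier B) \<xi> * cnj (fourier v \<xi>) =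
        fourier u \<xi> * cnj (fourier v \<xi>)"
      using fourier_inv_fourier[OF B]
    proof eventually_elim
      case (elim \<xi>)
      have "complex_of_real (bessel_symbol s \<xi>) * of_real (bessel_symbol (- s) \<xi>) = 1"
        using bessel_symbol_add[of s \<xi> "- s"] by (simp add: bessel_symbol_0 flip: of_real_mult)
      then show ?case
        unfolding elim B_def by (simp add: mult.assoc[symmetric])
    qed
  qed
  also have "\<dots> = L2_inner u v"
    using plancherel[OF u v] by (simp add: L2_inner_def)
  finally show ?thesis .
qed

text \<open>
  An element of the Sobolev space is determined almost everywhere by its inner products with the
  elements of the space.
\<close>

lemma sobolev_representer_unique:
  fixes w w' :: "'a::euclidean_space \<Rightarrow> complex"
  assumes w: "w \<in> sobolev_space s" and w': "w' \<in> sobolev_space s"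
    and eq: "\<And>v. v \<in> sobolev_space s \<Longrightarrow> sobolev_inner s w v = sobolev_inner s w' v"
  shows "AE x in lebesgue. w x = w' x"
proof -
  let ?b = "\<lambda>\<xi>. complex_of_real (bessel_symbol (s / 2) \<xi>)"
  define h where "h \<xi> = fourier w \<xi> - fourier w' \<xi>" for \<xi>
  have wL: "w \<in> L2" "w' \<in> L2" "(\<lambda>\<xi>. ?b \<xi> * fourier w \<xi>) \<in> L2" "(\<lambda>\<xi>. ?b \<xi> * fourier w' \<xi>) \<in> L2"
    using w w' by (auto simp: sobolev_space_def)
  have hL: "h \<in> L2"
    unfolding h_def[abs_def] by (intro L2_diff fourier_L2 wL)
  have bh: "(\<lambda>\<xi>. ?b \<xi> * h \<xi>) = (\<lambda>\<xi>. ?b \<xi> * fourier w \<xi> - ?b \<xi> * fourier w' \<xi>)"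
    by (simp add: h_def algebra_simps)
  have bhL: "(\<lambda>\<xi>. ?b \<xi> * h \<xi>) \<in> L2"
    unfolding bh by (intro L2_diff wL)
  \<comment> \<open>the test function is \<open>w - w'\<close> itself, up to a null set; defining it through its transform
    dispenses with the linearity of \<open>fourier\<close>\<close>
  define v where "v = inv_fourier h"
  have v: "v \<in> sobolev_space s"
    unfolding v_def by (rule inv_fourier_in_sobolev[OF hL bhL])
  have bvL: "(\<lambda>\<xi>. ?b \<xi> * fourier v \<xi>) \<in> L2"
    using v by (simp add: sobolev_space_def)
  have "L2_inner (\<lambda>\<xi>. ?b \<xi> * h \<xi>) (\<lambda>\<xi>. ?b \<xi> * h \<xi>) = L2_inner (\<lambda>\<xi>. ?b \<xi> * h \<xi>) (\<lambda>\<xi>. ?b \<xi> * fourier v \<xi>)"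
    by (rule L2_inner_cong_AE[OF bhL bhL bhL bvL])
      (simp, use fourier_inv_fourier[OF hL, folded v_def] in eventually_elim, simp)
  also have "\<dots> = sobolev_inner s w v - sobolev_inner s w' v"
    unfolding bh sobolev_inner_eq_L2_inner by (rule L2_inner_diff_left[OF wL(3,4) bvL])
  also have "\<dots> = 0"
    using eq[OF v] by simp
  finally have "AE \<xi> in lebesgue. ?b \<xi> * h \<xi> = 0"
    by (rule L2_inner_self_eq_0_AE[OF bhL])
  then have "AE \<xi> in lebesgue. fourier w \<xi> = fourier w' \<xi>"
    by eventually_elim (use bessel_symbol_pos in \<open>auto simp: h_def less_le\<close>)
  from inv_fourier_cong_AE[OF fourier_L2[OF wL(1)] fourier_L2[OF wL(2)] this]
    inv_fourier_fourier[OF wL(1)] inv_fourier_fourier[OF wL(2)]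
  show ?thesis by eventually_elim simp
qed

theorem proposition4p3:
  fixes s :: real and u :: "real ^ 'n \<Rightarrow> complex"
  assumes "0 \<le> s" and "u \<in> L2"
  shows "AE x in lebesgue. sobolev_embedding_adjoint s u x = bessel_potential (2 * s) u x"
proof -
  let ?P = "\<lambda>w. w \<in> sobolev_space s \<and> (\<forall>v \<in> sobolev_space s. sobolev_inner s w v = L2_inner u v)"
  have bp: "?P (bessel_potential (2 * s) u)"
    using bessel_potential_in_sobolev[OF assms] sobolev_inner_bessel_potential[OF assms]
    by (auto simp: sobolev_space_def)
  then have "?P (sobolev_embedding_adjoint s u)"
    unfolding sobolev_embedding_adjoint_def by (rule someI[of ?P])
  with bp show ?thesis
    by (intro sobolev_representer_unique[of _ s]) auto
qed

end
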